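(* Let $H$ be a graph. Then the following are equivalent: (i) $H$ is norming; (ii) $t_H(\cdot)$ is strictly convex on the set of signed graphons; (iii) for every $n\in\mathbb{N}$, $P_{H,n}$ is a strictly convex polynomial on $\mathcal{S}_n$; (iv) for every $n\in\mathbb{N}$, $P_{H,n}(\cdot)^{1/e(H)}$ is a norm on $\mathcal{S}_n$.
   Context: A signed graphon is a symmetric measurable function $W:[0,1]^2\to[-1,1]$; the set of signed graphons is a convex subset of the real vector space $\mathcal{W}$ of symmetric bounded measurable functions on $[0,1]^2$. For a graph $H$ and $W\in\mathcal{W}$, $t_H(W)=\int_{[0,1]^{V(H)}}\prod_{ij\in E(H)}W(x_i,x_j)\,d\mu^{v(H)}$, with $\mu$ Lebesgue measure. $H$ is norming if $W\mapsto|t_H(W)|^{1/e(H)}$ is a norm on $\mathcal{W}$. $\mathcal{S}_n$ denotes the real vector space of $n\times n$ symmetric matrices. For $A=(a_{ij})\in\mathcal{S}_n$, $P_{H,n}(A):=\sum_{\phi:V(H)\to[n]}\prod_{uv\in E(H)}a_{\phi(u)\phi(v)}$. A function $f$ on a convex set is strictly convex if $f(\lambda x+(1-\lambda)y)<\lambda f(x)+(1-\lambda)f(y)$ for all distinct $x,y$ and $\lambda\in(0,1)$. *)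

theory Defs
  imports "HOL-Analysis.Analysis" "Jordan_Normal_Form.Matrix"
begin

definition simple_graph :: "'a set \<Rightarrow> 'a set set \<Rightarrow> bool" where
  "simple_graph V E \<longleftrightarrow> finite V \<and> (\<forall>e\<in>E. e \<subseteq> V \<and> card e = 2)"

text \<open>
  The vector spaces below are given by a carrier \<open>S\<close> with explicit operations. The relation
  \<open>veq\<close> is the equality of the space: almost everywhere equality for kernels, as usual for
  spaces of measurable functions, and plain equality for matrices.
\<close>

definition is_norm_on ::
  "'v set \<Rightarrow> ('v \<Rightarrow> 'v \<Rightarrow> 'v) \<Rightarrow> (real \<Rightarrow> 'v \<Rightarrow> 'v) \<Rightarrow> 'v \<Rightarrow> ('v \<Rightarrow> 'v \<Rightarrow> bool) \<Rightarrow> ('v \<Rightarrow> real) \<Rightarrow> bool" where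
  "is_norm_on S vadd vscale vzero veq N \<longleftrightarrow>
     (\<forall>x\<in>S. 0 \<le> N x) \<and>
     (\<forall>x\<in>S. N x = 0 \<longleftrightarrow> veq x vzero) \<and>
     (\<forall>c. \<forall>x\<in>S. N (vscale c x) = \<bar>c\<bar> * N x) \<and>
     (\<forall>x\<in>S. \<forall>y\<in>S. N (vadd x y) \<le> N x + N y)"

definition is_strictly_convex_on ::
  "'v set \<Rightarrow> ('v \<Rightarrow> 'v \<Rightarrow> 'v) \<Rightarrow> (real \<Rightarrow> 'v \<Rightarrow> 'v) \<Rightarrow> ('v \<Rightarrow> 'v \<Rightarrow> bool) \<Rightarrow> ('v \<Rightarrow> real) \<Rightarrow> bool" where
  "is_strictly_convex_on S vadd vscale veq f \<longleftrightarrow>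
     (\<forall>x\<in>S. \<forall>y\<in>S. \<forall>c::real. \<not> veq x y \<longrightarrow> 0 < c \<longrightarrow> c < 1 \<longrightarrow>
        f (vadd (vscale c x) (vscale (1 - c) y)) < c * f x + (1 - c) * f y)"

abbreviation unit_square :: "(real \<times> real) set" where
  "unit_square \<equiv> {0..1} \<times> {0..1}"

definition symmetric_kernel :: "(real \<times> real \<Rightarrow> real) \<Rightarrow> bool" where
  "symmetric_kernel W \<longleftrightarrow> (\<forall>x\<in>{0..1}. \<forall>y\<in>{0..1}. W (x, y) = W (y, x))"

definition bounded_kernels :: "(real \<times> real \<Rightarrow> real) set" where
  "bounded_kernels =
     {W. W \<in> borel_measurable (lebesgue_on unit_square) \<and> symmetric_kernel W \<and>
         bounded (W ` unit_square)}"

definition signed_graphons :: "(real \<times> real \<Rightarrow> real) set" where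
  "signed_graphons =
     {W. W \<in> borel_measurable (lebesgue_on unit_square) \<and> symmetric_kernel W \<and>
         W ` unit_square \<subseteq> {-1..1}}"

definition kernel_add ::
  "(real \<times> real \<Rightarrow> real) \<Rightarrow> (real \<times> real \<Rightarrow> real) \<Rightarrow> real \<times> real \<Rightarrow> real" where
  "kernel_add U W = (\<lambda>p. U p + W p)"

definition kernel_scale :: "real \<Rightarrow> (real \<times> real \<Rightarrow> real) \<Rightarrow> real \<times> real \<Rightarrow> real" where
  "kernel_scale c W = (\<lambda>p. c * W p)"

definition kernel_eq :: "(real \<times> real \<Rightarrow> real) \<Rightarrow> (real \<times> real \<Rightarrow> real) \<Rightarrow> bool" where
  "kernel_eq U W \<longleftrightarrow> (AE p in lebesgue_on unit_square. U p = W p)"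

text \<open>
  For an edge \<open>e = {u, v}\<close> and \<open>F\<close> symmetric on the values of \<open>x\<close>, this is \<open>F (x u, x v)\<close>;
  see \<open>edge_value_eq\<close>.
\<close>

definition edge_value :: "('b \<times> 'b \<Rightarrow> real) \<Rightarrow> ('a \<Rightarrow> 'b) \<Rightarrow> 'a set \<Rightarrow> real" where
  "edge_value F x e = (THE r. \<exists>u v. e = {u, v} \<and> r = F (x u, x v))"

lemma edge_value_eq:
  assumes "F (x u, x v) = F (x v, x u)"
  shows "edge_value F x {u, v} = F (x u, x v)"
  unfolding edge_value_def
proof (rule the_equality)
  show "\<exists>u' v'. {u, v} = {u', v'} \<and> F (x u, x v) = F (x u', x v')"
    by blast
next
  fix r assume "\<exists>u' v'. {u, v} = {u', v'} \<and> r = F (x u', x v')"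
  then obtain u' v' where "{u, v} = {u', v'}" and r: "r = F (x u', x v')"
    by blast
  then have "u' = u \<and> v' = v \<or> u' = v \<and> v' = u"
    by (auto simp: doubleton_eq_iff)
  then show "r = F (x u, x v)"
    using r assms by auto
qed

text \<open>
  The measure on \<open>[0,1]\<^sup>V\<close> is completed because the integrand is in general only
  Lebesgue measurable when \<open>W\<close> is.
\<close>

definition hom_density :: "'a set \<Rightarrow> 'a set set \<Rightarrow> (real \<times> real \<Rightarrow> real) \<Rightarrow> real" where
  "hom_density V E W =
     (LINT x | completion (\<Pi>\<^sub>M v\<in>V. restrict_space lborel {0..1}). (\<Prod>e\<in>E. edge_value W x e))"

text \<open>
  Here \<open>root 0\<close> is constantly \<open>0\<close>, so an edgeless graph is not norming.
\<close>

definition norming :: "'a set \<Rightarrow> 'a set set \<Rightarrow> bool" where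
  "norming V E \<longleftrightarrow>
     is_norm_on bounded_kernels kernel_add kernel_scale (\<lambda>p. 0) kernel_eq
       (\<lambda>W. root (card E) \<bar>hom_density V E W\<bar>)"

definition symmetric_mats :: "nat \<Rightarrow> real mat set" where
  "symmetric_mats n = {A \<in> carrier_mat n n. transpose_mat A = A}"

text \<open>Rows and columns are indexed by \<open>{0, \<dots>, n - 1}\<close>.\<close>

definition hom_poly :: "'a set \<Rightarrow> 'a set set \<Rightarrow> nat \<Rightarrow> real mat \<Rightarrow> real" where
  "hom_poly V E n A =
     (\<Sum>\<phi>\<in>V \<rightarrow>\<^sub>E {..<n}. \<Prod>e\<in>E. edge_value (\<lambda>p. A $$ p) \<phi> e)"

end

theory Submission
  imports Defs "HOL-Probability.Probability" "HOL-Real_Asymp.Real_Asymp"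
begin

text \<open>
  Let \<open>m\<close> be the number of edges. Both the homomorphism density and the homomorphism polynomial are
  homogeneous of degree \<open>m\<close> and restrict to a polynomial in one variable on every line. If the \<open>m\<close>-th root
  of such a form is a norm, the form is convex, and equality in the convexity inequality would make it affine
  and hence constant on a whole line, which is impossible for a norm. Conversely, strict convexity together
  with homogeneity gives positivity and the triangle inequality.

  Matrices embed into kernels as step kernels. In the other direction, the expected homomorphism polynomial of
  the matrix \<open>W (x i, x j)\<close> at \<open>n\<close> random points, divided by \<open>n\<close> to the number of vertices, tends to the density
  of \<open>W\<close>, so nonnegativity and convexity pass from matrices to kernels. Definiteness does not pass to the limit.
  It is recovered as follows: positivity at the matrix with rows \<open>(1, -1)\<close> and \<open>(-1, 1)\<close> forces all degrees to
  be even, and if \<open>W\<close> has density \<open>0\<close>, the first-order term at \<open>t = 0\<close> of the density of \<open>1\<^bsub>S\<times>S\<^esub> + t W\<close>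
  vanishes, which says that \<open>W\<close> integrates to \<open>0\<close> over \<open>S \<times> S\<close>, for every Borel set \<open>S\<close>.
\<close>

section \<open>Homogeneous forms: strict convexity and norms\<close>

text \<open>Three obstacles shape the proof. A kernel is Lebesgue measurable, is controlled on the
  unit square alone, and counts only up to null sets; it is therefore replaced by a Borel
  representative that is symmetric and bounded on the whole plane and can be evaluated at arbitrary
  points. Norming is defined through the absolute value of the density, whereas convexity concerns
  the density itself; that a norming graph has nonnegative density needs its own argument, in which
  a sign change along a segment produces a zero, and definiteness makes the segment run through the
  zero kernel. Finally, strict inequalities become weak in the sampling limit, so strict convexity
  for kernels is reached through the norm: weak convexity and positivity give a norm, and the norm
  gives strictness back. Even degrees matter because a vertex on one edge then lies on a second one:
  after one edge factor of the indicator of S x S is replaced by W, the other edges still confine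
  every non-isolated vertex to S. A graph without edges satisfies none of the four
  conditions.\<close>

lemma convex_poly_touching_chord:
  fixes p :: "real poly"
  assumes conv: "convex_on UNIV (poly p)" and nonneg: "\<And>t. 0 \<le> poly p t"
    and c: "0 < c" "c < 1" and touch: "c * poly p 1 + (1 - c) * poly p 0 \<le> poly p c"
  shows "poly p t = poly p 0"
proof -
  \<comment> \<open>\<open>q\<close> is the height of \<open>p\<close> above its chord over [0,1],
    still convex. If it were negative at some s in (0,1), convexity between s and an endpoint would
    make it negative at \<open>c\<close>, where it is nonnegative. So \<open>q\<close> has
    infinitely many roots and \<open>p\<close> is affine.\<close>
  define q where "q = p - [:poly p 0, poly p 1 - poly p 0:]"
  have q: "poly q t = poly p t - poly p 0 - t * (poly p 1 - poly p 0)" for t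
    by (simp add: q_def)
  have q_conv: "poly q ((1 - l) * x + l * y) \<le> (1 - l) * poly q x + l * poly q y"
    if "0 \<le> l" "l \<le> 1" for l x y
    using convex_onD[OF conv, of l x y] that unfolding q by (simp add: algebra_simps)
  have q01: "poly q 0 = 0" "poly q 1 = 0" and qc: "0 \<le> poly q c"
    using touch by (auto simp: q algebra_simps)
  have zero: "poly q s = 0" if s: "s \<in> {0<..<1}" for s
  proof (rule antisym)
    show "poly q s \<le> 0"
      using q_conv[of s 0 1] s q01 by simp
    show "0 \<le> poly q s"
    proof (cases "s \<le> c")
      case True
      \<comment> \<open>The weight that places \<open>c\<close> between \<open>s\<close> and 1;
        \<open>l < 1\<close> keeps a positive share for \<open>s\<close>.\<close>
      define l where "l = (c - s) / (1 - s)"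
      have l: "0 \<le> l" "l < 1"
        using s c True by (auto simp: l_def field_simps)
      have "l * (1 - s) = c - s"
        using s by (simp add: l_def)
      then have lc: "(1 - l) * s + l * 1 = c"
        by (simp add: algebra_simps)
      have "poly q c \<le> (1 - l) * poly q s"
        using q_conv[of l s 1] l q01 unfolding lc by simp
      then have "0 \<le> (1 - l) * poly q s"
        using qc by linarith
      then show ?thesis
        using l by (simp add: zero_le_mult_iff)
    next
      case False
      define l where "l = c / s"
      have l: "0 < l" "l \<le> 1" and lc: "(1 - l) * 0 + l * s = c"
        using s c False by (auto simp: l_def field_simps)
      have "poly q c \<le> l * poly q s"
        using q_conv[of l 0 s] l q01 unfolding lc by simp
      then have "0 \<le> l * poly q s"
        using qc by linarith
      then show ?thesis
        using l by (simp add: zero_le_mult_iff)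
    qed
  qed
  have "q = 0"
  proof (rule ccontr)
    assume "q \<noteq> 0"
    then have "finite {x. poly q x = 0}"
      by (rule poly_roots_finite)
    moreover have "{0<..<1} \<subseteq> {x. poly q x = 0}"
      using zero by blast
    ultimately have "finite {0<..<1::real}"
      by (rule rev_finite_subset)
    then show False
      using infinite_Ioo[of 0 "1::real"] by simp
  qed
  then have aff: "poly p t = poly p 0 + t * (poly p 1 - poly p 0)" for t
    using q[of t] by simp
  have "poly p 1 - poly p 0 = 0"
  proof (rule ccontr)
    assume d: "poly p 1 - poly p 0 \<noteq> 0"
    \<comment> \<open>The point at which a non-constant affine \<open>p\<close> would take the value
      -1.\<close>
    define t where "t = (- 1 - poly p 0) / (poly p 1 - poly p 0)"
    have "t * (poly p 1 - poly p 0) = - 1 - poly p 0"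
      using d by (simp add: t_def)
    then have "poly p t = - 1"
      using aff[of t] by simp
    then show False
      using nonneg[of t] by simp
  qed
  then show ?thesis
    using aff[of t] by simp
qed

lemma is_strictly_convex_onD:
  assumes "is_strictly_convex_on S vadd vscale veq f"
    and "x \<in> S" "y \<in> S" "\<not> veq x y" "0 < c" "c < 1"
  shows "f (vadd (vscale c x) (vscale (1 - c) y)) < c * f x + (1 - c) * f y"
  using assms unfolding is_strictly_convex_on_def by blast

text \<open>Covers matrices and kernels at once. The vector space laws hold as equalities of
  representatives, and \<open>veq\<close> enters only where two vectors are compared or the form is
  evaluated. No sign is assumed for \<open>f\<close>: that is part of what has to be shown.\<close>

locale homogeneous_form =
  fixes S :: "'v set" and vadd :: "'v \<Rightarrow> 'v \<Rightarrow> 'v" and vscale :: "real \<Rightarrow> 'v \<Rightarrow> 'v"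
    and vzero :: 'v and veq :: "'v \<Rightarrow> 'v \<Rightarrow> bool" and f :: "'v \<Rightarrow> real" and m :: nat
  assumes m_pos: "0 < m"
    and zero_closed: "vzero \<in> S"
    and add_closed: "\<And>x y. x \<in> S \<Longrightarrow> y \<in> S \<Longrightarrow> vadd x y \<in> S"
    and scale_closed: "\<And>a x. x \<in> S \<Longrightarrow> vscale a x \<in> S"
    and add_assoc: "\<And>x y z. x \<in> S \<Longrightarrow> y \<in> S \<Longrightarrow> z \<in> S \<Longrightarrow> vadd (vadd x y) z = vadd x (vadd y z)"
    and add_commute: "\<And>x y. x \<in> S \<Longrightarrow> y \<in> S \<Longrightarrow> vadd x y = vadd y x"
    and add_zero: "\<And>x. x \<in> S \<Longrightarrow> vadd x vzero = x"
    and scale_zero: "\<And>a. vscale a vzero = vzero"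
    and zero_scale: "\<And>x. x \<in> S \<Longrightarrow> vscale 0 x = vzero"
    and scale_one: "\<And>x. x \<in> S \<Longrightarrow> vscale 1 x = x"
    and scale_scale: "\<And>a b x. x \<in> S \<Longrightarrow> vscale a (vscale b x) = vscale (a * b) x"
    and scale_add: "\<And>a x y. x \<in> S \<Longrightarrow> y \<in> S \<Longrightarrow> vscale a (vadd x y) = vadd (vscale a x) (vscale a y)"
    and add_scale: "\<And>a b x. x \<in> S \<Longrightarrow> vadd (vscale a x) (vscale b x) = vscale (a + b) x"
    and veq_add: "\<And>x y z. x \<in> S \<Longrightarrow> y \<in> S \<Longrightarrow> z \<in> S \<Longrightarrow> veq x y \<Longrightarrow> veq (vadd x z) (vadd y z)"
    and veq_scale: "\<And>a x y. x \<in> S \<Longrightarrow> y \<in> S \<Longrightarrow> veq x y \<Longrightarrow> veq (vscale a x) (vscale a y)"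
    and veq_diff: "\<And>x y. x \<in> S \<Longrightarrow> y \<in> S \<Longrightarrow> veq (vadd x (vscale (- 1) y)) vzero \<Longrightarrow> veq x y"
    and form_cong: "\<And>x y. x \<in> S \<Longrightarrow> y \<in> S \<Longrightarrow> veq x y \<Longrightarrow> f x = f y"
    and form_scale: "\<And>a x. x \<in> S \<Longrightarrow> f (vscale a x) = a ^ m * f x"
    and form_poly: "\<And>x y. x \<in> S \<Longrightarrow> y \<in> S \<Longrightarrow> \<exists>p. \<forall>t. f (vadd (vscale t x) (vscale (1 - t) y)) = poly p t"
begin

lemma zero_add: "x \<in> S \<Longrightarrow> vadd vzero x = x"
  using add_commute[of vzero x] by (simp add: zero_closed add_zero)

lemma add_interchange:
  assumes "x \<in> S" "y \<in> S" "z \<in> S" "w \<in> S"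
  shows "vadd (vadd x y) (vadd z w) = vadd (vadd x z) (vadd y w)"
proof -
  have "vadd (vadd x y) (vadd z w) = vadd x (vadd (vadd y z) w)"
    using assms by (simp add: add_assoc add_closed)
  also have "vadd y z = vadd z y"
    using assms by (intro add_commute)
  also have "vadd x (vadd (vadd z y) w) = vadd (vadd x z) (vadd y w)"
    using assms by (simp add: add_assoc add_closed)
  finally show ?thesis .
qed

lemma form_zero: "f vzero = 0"
  using form_scale[OF zero_closed, of 0] m_pos by (simp add: scale_zero power_0_left)

text \<open>At the midpoint of x and 0 strict convexity reads 2^(-m) f x < f x / 2. Since 2^(-m)
  \<le> 1/2, this forces f x > 0.\<close>

lemma strictly_convex_imp_pos:
  assumes sc: "is_strictly_convex_on S vadd vscale veq f" and x: "x \<in> S" "\<not> veq x vzero"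
  shows "0 < f x"
proof -
  have "f (vadd (vscale (1/2) x) (vscale (1 - 1/2) vzero)) < 1/2 * f x + (1 - 1/2) * f vzero"
    using x zero_closed by (intro is_strictly_convex_onD[OF sc]) auto
  then have *: "(1/2) ^ m * f x < 1/2 * f x"
    by (simp add: scale_zero add_zero scale_closed form_scale form_zero x)
  have "(1/2::real) ^ m \<le> 1/2"
    using m_pos power_decreasing[of 1 m "1/2::real"] by simp
  then have "0 \<le> (1/2 - (1/2::real) ^ m)"
    by simp
  moreover have "0 < (1/2 - (1/2::real) ^ m) * f x"
    using * by (simp add: algebra_simps)
  ultimately show ?thesis
    by (simp add: zero_less_mult_iff)
qed

lemma strictly_convex_imp_convex:
  assumes sc: "is_strictly_convex_on S vadd vscale veq f" and x: "x \<in> S" and y: "y \<in> S"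
    and c: "0 \<le> c" "c \<le> 1"
  shows "f (vadd (vscale c x) (vscale (1 - c) y)) \<le> c * f x + (1 - c) * f y"
proof (cases "veq x y")
  case True
  have "veq (vadd (vscale c x) (vscale (1 - c) y)) (vadd (vscale c y) (vscale (1 - c) y))"
    using x y True by (intro veq_add veq_scale scale_closed)
  then have "f (vadd (vscale c x) (vscale (1 - c) y)) = f y"
    using x y by (subst form_cong[of _ y]) (auto simp: add_scale scale_one add_closed scale_closed)
  moreover have "f x = f y"
    using form_cong[OF x y True] .
  ultimately show ?thesis
    by (simp add: algebra_simps)
next
  case False
  consider "c = 0" | "c = 1" | "0 < c" "c < 1"
    using c by linarith
  then show ?thesis
  proof cases
    case 1
    then show ?thesis
      using x y by (simp add: zero_scale scale_one zero_add)
  next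
    case 2
    then show ?thesis
      using x y by (simp add: zero_scale scale_one add_zero)
  next
    case 3
    then show ?thesis
      using x y False by (intro less_imp_le is_strictly_convex_onD[OF sc])
  qed
qed

text \<open>The unit ball argument: vectors normalised to f = 1 have convex combinations with f
  \<le> 1, and homogeneity turns this into the triangle inequality.\<close>

theorem convex_imp_norm:
  assumes pos: "\<And>x. x \<in> S \<Longrightarrow> \<not> veq x vzero \<Longrightarrow> 0 < f x"
    and conv: "\<And>x y c. x \<in> S \<Longrightarrow> y \<in> S \<Longrightarrow> 0 \<le> c \<Longrightarrow> c \<le> 1 \<Longrightarrow>
      f (vadd (vscale c x) (vscale (1 - c) y)) \<le> c * f x + (1 - c) * f y"
  shows "is_norm_on S vadd vscale vzero veq (\<lambda>x. root m (f x))"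
  unfolding is_norm_on_def
proof (intro conjI ballI allI)
  have nonneg: "0 \<le> f x" if "x \<in> S" for x
    using pos[of x] form_cong[of x vzero] form_zero zero_closed that by (cases "veq x vzero") auto
  fix x assume x: "x \<in> S"
  show "0 \<le> root m (f x)"
    using nonneg[OF x] m_pos by simp
  show "root m (f x) = 0 \<longleftrightarrow> veq x vzero"
    using pos[OF x] form_cong[OF x zero_closed] form_zero m_pos by (cases "veq x vzero") auto
  show "root m (f (vscale c x)) = \<bar>c\<bar> * root m (f x)" for c
  proof -
    \<comment> \<open>Nonnegativity at both \<open>x\<close> and its multiple yields the absolute
      value without a discussion of the parity of \<open>m\<close>.\<close>
    have "f (vscale c x) = \<bar>c ^ m * f x\<bar>"
      using nonneg[OF scale_closed[OF x], of c] by (simp add: form_scale x)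
    also have "\<dots> = \<bar>c\<bar> ^ m * f x"
      using nonneg[OF x] by (simp add: abs_mult power_abs)
    finally show ?thesis
      using m_pos by (simp add: real_root_mult real_root_power_cancel)
  qed
  fix y assume y: "y \<in> S"
  show "root m (f (vadd x y)) \<le> root m (f x) + root m (f y)"
  \<comment> \<open>A vector equivalent to zero cannot be normalised and is treated
    separately.\<close>
  proof (cases "veq x vzero \<or> veq y vzero")
    case True
    then have "f (vadd x y) = f x + f y \<and> (f x = 0 \<or> f y = 0)"
    proof
      assume *: "veq x vzero"
      have "veq (vadd x y) (vadd vzero y)"
        using x y zero_closed * by (intro veq_add)
      then have "f (vadd x y) = f y"
        using x y zero_closed by (simp add: form_cong zero_add add_closed)
      then show ?thesis
        using form_cong[OF x zero_closed *] form_zero by simp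
    next
      assume *: "veq y vzero"
      have "veq (vadd y x) (vadd vzero x)"
        using x y zero_closed * by (intro veq_add)
      then have "f (vadd x y) = f x"
        using x y zero_closed add_commute[of x y]
        by (simp add: form_cong zero_add add_closed)
      then show ?thesis
        using form_cong[OF y zero_closed *] form_zero by simp
    qed
    then show ?thesis
      using nonneg[OF x] nonneg[OF y] m_pos by auto
  next
    case False
    define a b where "a = root m (f x)" and "b = root m (f y)"
    have ab: "0 < a" "0 < b" "a ^ m = f x" "b ^ m = f y"
      using False pos[OF x] pos[OF y] m_pos by (auto simp: a_def b_def less_imp_le)
    \<comment> \<open>Chosen so that x + y = (a + b) (c x' + (1 - c) y') for the normalised vectors
      x' and y'.\<close>
    define c where "c = a / (a + b)"
    have c: "0 \<le> c" "c \<le> 1" "1 - c = b / (a + b)"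
      using ab by (auto simp: c_def field_simps)
    define x' y' where "x' = vscale (1 / a) x" and "y' = vscale (1 / b) y"
    have S': "x' \<in> S" "y' \<in> S"
      using x y by (auto simp: x'_def y'_def scale_closed)
    have f': "f x' = 1" "f y' = 1"
      using ab x y by (auto simp: x'_def y'_def form_scale power_divide)
    have "(a + b) * c = a" "(a + b) * (1 - c) = b"
      using ab by (simp_all only: c(3)) (simp_all add: c_def)
    then have "(a + b) * c * (1 / a) = 1" "(a + b) * (1 - c) * (1 / b) = 1"
      using ab by simp_all
    then have "vadd x y = vscale (a + b) (vadd (vscale c x') (vscale (1 - c) y'))"
      using x y S' by (simp add: scale_add scale_closed scale_scale scale_one x'_def y'_def mult.assoc)
    then have "f (vadd x y) = (a + b) ^ m * f (vadd (vscale c x') (vscale (1 - c) y'))"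
      using S' by (simp add: form_scale add_closed scale_closed)
    also have "\<dots> \<le> (a + b) ^ m * 1"
      using conv[OF S' c(1,2)] f' ab by (intro mult_left_mono) auto
    finally have "root m (f (vadd x y)) \<le> root m ((a + b) ^ m)"
      using m_pos by simp
    also have "\<dots> = a + b"
      using ab m_pos by (simp add: real_root_power_cancel)
    finally show ?thesis
      by (simp add: a_def b_def)
  qed
qed

theorem norm_imp_strictly_convex:
  assumes norm: "is_norm_on S vadd vscale vzero veq (\<lambda>x. root m (f x))"
  shows "is_strictly_convex_on S vadd vscale veq f"
  unfolding is_strictly_convex_on_def
proof (intro ballI allI impI)
  fix x y c
  assume x: "x \<in> S" and y: "y \<in> S" and xy: "\<not> veq x y" and c: "0 < (c::real)" "c < 1"
  define N where "N z = root m (f z)" for z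
  have N_nonneg: "0 \<le> N z" if "z \<in> S" for z
    using norm that by (simp add: is_norm_on_def N_def)
  have N_add: "N (vadd z w) \<le> N z + N w" if "z \<in> S" "w \<in> S" for z w
    using norm that by (simp add: is_norm_on_def N_def)
  have N_scale: "N (vscale a z) = \<bar>a\<bar> * N z" if "z \<in> S" for z a
    using norm that by (simp add: is_norm_on_def N_def)
  have f_N: "f z = N z ^ m" if "z \<in> S" for z
    using N_nonneg[OF that] m_pos by (simp add: N_def)
  define z where "z t = vadd (vscale t x) (vscale (1 - t) y)" for t
  have z_S: "z t \<in> S" for t
    using x y by (simp add: z_def add_closed scale_closed)
  obtain p where p: "\<And>t. f (z t) = poly p t"
    using form_poly[OF x y] by (auto simp: z_def)
  have z_comb: "z ((1 - l) * s + l * t) = vadd (vscale (1 - l) (z s)) (vscale l (z t))" for l s t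
  proof -
    have "vadd (vscale (1 - l) (z s)) (vscale l (z t)) =
        vadd (vadd (vscale ((1 - l) * s) x) (vscale ((1 - l) * (1 - s)) y))
             (vadd (vscale (l * t) x) (vscale (l * (1 - t)) y))"
      using x y by (simp add: z_def scale_add scale_scale scale_closed)
    also have "\<dots> = vadd (vadd (vscale ((1 - l) * s) x) (vscale (l * t) x))
        (vadd (vscale ((1 - l) * (1 - s)) y) (vscale (l * (1 - t)) y))"
      using x y by (intro add_interchange scale_closed)
    also have "\<dots> = z ((1 - l) * s + l * t)"
      using x y by (simp add: z_def add_scale) (simp add: algebra_simps)
    finally show ?thesis
      by simp
  qed
  \<comment> \<open>Along the line \<open>N\<close> is convex and nonnegative, and the m-th power is
    convex and increasing on the nonnegative reals.\<close>
  have conv: "convex_on UNIV (poly p)"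
  proof (rule convex_onI)
    fix l s t :: real
    assume l: "0 < l" "l < 1"
    have "N (z ((1 - l) * s + l * t)) \<le> (1 - l) * N (z s) + l * N (z t)"
      using N_add[of "vscale (1 - l) (z s)" "vscale l (z t)"] l z_S
      by (simp add: z_comb scale_closed N_scale)
    then have "N (z ((1 - l) * s + l * t)) ^ m \<le> ((1 - l) * N (z s) + l * N (z t)) ^ m"
      using z_S by (intro power_mono N_nonneg)
    also have "\<dots> \<le> (1 - l) * N (z s) ^ m + l * N (z t) ^ m"
    proof -
      have "convex_on {0..} (\<lambda>x::real. x ^ m)"
        using convex_power_even[of m] convex_power_odd[of m]
        by (cases "even m") (auto intro: convex_on_subset)
      from convex_onD[OF this, of l "N (z s)" "N (z t)"] show ?thesis
        using l N_nonneg z_S by simp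
    qed
    finally show "poly p ((1 - l) *\<^sub>R s + l *\<^sub>R t) \<le> (1 - l) * poly p s + l * poly p t"
      using p f_N z_S by simp
  qed simp
  have nonneg: "0 \<le> poly p t" for t
    using f_N[OF z_S] N_nonneg[OF z_S] p by (metis zero_le_power)
  have z1: "f (z 1) = f x" and z0: "f (z 0) = f y"
    using x y by (simp_all add: z_def zero_scale scale_one zero_add add_zero)
  show "f (vadd (vscale c x) (vscale (1 - c) y)) < c * f x + (1 - c) * f y"
  proof (rule ccontr)
    assume "\<not> ?thesis"
    then have "c * poly p 1 + (1 - c) * poly p 0 \<le> poly p c"
      using p[of 1] p[of 0] p[of c] z0 z1 by (simp add: z_def)
    then have const: "poly p t = poly p 0" for t
      using convex_poly_touching_chord[OF conv nonneg c] by blast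
    then have N_const: "N (z t) = N y" for t
      using p[of t] p[of 0] z0 const[of t] unfolding N_def by metis
    define d where "d = vadd x (vscale (- 1) y)"
    have d: "d \<in> S"
      using x y by (simp add: d_def add_closed scale_closed)
    have td: "vscale t d = vadd (z t) (vscale (- 1) y)" for t
    proof -
      have "vadd (z t) (vscale (- 1) y) = vadd (vscale t x) (vadd (vscale (1 - t) y) (vscale (- 1) y))"
        using x y by (simp add: z_def add_assoc scale_closed)
      also have "\<dots> = vadd (vscale t x) (vscale (- t) y)"
        using y by (simp add: add_scale)
      also have "\<dots> = vscale t d"
        using x y by (simp add: d_def scale_add scale_scale scale_closed)
      finally show ?thesis
        by simp
    qed
    \<comment> \<open>A norm constant on the whole line y + t d is bounded there, so |t| N d stays
      bounded and N d = 0. This is where definiteness excludes equality.\<close>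
    have bound: "\<bar>t\<bar> * N d \<le> 2 * N y" for t
      using N_add[of "z t" "vscale (- 1) y"] N_scale[OF d, of t] N_scale[OF y, of "- 1"] N_const[of t] z_S y
      by (simp add: td scale_closed)
    have "N d = 0"
    proof (rule ccontr)
      assume "N d \<noteq> 0"
      then have "0 < N d"
        using N_nonneg[OF d] by simp
      then show False
        using bound[of "(2 * N y + 1) / N d"] N_nonneg[OF y] by (simp add: field_simps)
    qed
    then have "veq d vzero"
      using norm d by (simp add: is_norm_on_def N_def)
    then show False
      using xy veq_diff[OF x y] by (simp add: d_def)
  qed
qed

theorem strictly_convex_imp_norm:
  assumes sc: "is_strictly_convex_on S vadd vscale veq f"
  shows "is_norm_on S vadd vscale vzero veq (\<lambda>x. root m (f x))"
  using strictly_convex_imp_pos[OF sc] strictly_convex_imp_convex[OF sc] by (rule convex_imp_norm)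

theorem strictly_convex_iff_norm:
  "is_strictly_convex_on S vadd vscale veq f \<longleftrightarrow>
     is_norm_on S vadd vscale vzero veq (\<lambda>x. root m (f x))"
  using strictly_convex_imp_norm norm_imp_strictly_convex by blast

end

section \<open>Homomorphism polynomials\<close>

text \<open>\<open>T\<close> is the set of factors from which the \<open>t\<close>-term is taken.
  Both matrices and kernels get their polynomial along a line from this expansion.\<close>

lemma prod_add_scaled:
  fixes g h :: "'b \<Rightarrow> real"
  assumes "finite E"
  shows "(\<Prod>e\<in>E. g e + t * h e) = (\<Sum>T\<in>Pow E. t ^ card T * (prod h T * prod g (E - T)))"
proof -
  have "(\<Prod>e\<in>E. g e + t * h e) = (\<Prod>e\<in>E. t * h e + g e)"
    by (simp add: add.commute)
  also have "\<dots> = (\<Sum>T\<in>Pow E. (\<Prod>e\<in>T. t * h e) * prod g (E - T))"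
    by (rule prod_add) fact
  also have "\<dots> = (\<Sum>T\<in>Pow E. t ^ card T * (prod h T * prod g (E - T)))"
    by (simp add: prod.distrib mult.assoc)
  finally show ?thesis .
qed

lemma poly_sum_Pow:
  fixes d :: "'b set \<Rightarrow> real"
  shows "(\<Sum>T\<in>Pow E. t ^ card T * d T) = poly (\<Sum>T\<in>Pow E. monom (d T) (card T)) t"
  by (simp add: poly_sum poly_monom mult.commute)

section \<open>The space of symmetric matrices\<close>

lemma symmetric_mats_swap:
  assumes "A \<in> symmetric_mats n" "i < n" "j < n"
  shows "A $$ (i, j) = A $$ (j, i)"
proof -
  have "transpose_mat A $$ (i, j) = A $$ (j, i)"
    using assms by (intro index_transpose_mat) (auto simp: symmetric_mats_def)
  then show ?thesis
    using assms by (simp add: symmetric_mats_def)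
qed

lemma symmetric_mats_dim:
  assumes "A \<in> symmetric_mats n"
  shows "dim_row A = n" "dim_col A = n"
  using assms by (auto simp: symmetric_mats_def)

lemma symmetric_matsI:
  assumes "A \<in> carrier_mat n n" "\<And>i j. i < n \<Longrightarrow> j < n \<Longrightarrow> A $$ (i, j) = A $$ (j, i)"
  shows "A \<in> symmetric_mats n"
  using assms by (auto simp: symmetric_mats_def intro!: eq_matI)

lemma symmetric_mats_add:
  assumes "A \<in> symmetric_mats n" "B \<in> symmetric_mats n"
  shows "A + B \<in> symmetric_mats n"
proof (rule symmetric_matsI)
  show "A + B \<in> carrier_mat n n"
    using assms by (simp add: symmetric_mats_def)
  fix i j assume ij: "i < n" "j < n"
  show "(A + B) $$ (i, j) = (A + B) $$ (j, i)"
    using ij assms[THEN symmetric_mats_dim(1)] assms[THEN symmetric_mats_dim(2)]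
      assms(1)[THEN symmetric_mats_swap, of i j] assms(2)[THEN symmetric_mats_swap, of i j] by simp
qed

lemma symmetric_mats_smult:
  assumes "A \<in> symmetric_mats n"
  shows "c \<cdot>\<^sub>m A \<in> symmetric_mats n"
proof (rule symmetric_matsI)
  show "c \<cdot>\<^sub>m A \<in> carrier_mat n n"
    using assms by (simp add: symmetric_mats_def)
  fix i j assume ij: "i < n" "j < n"
  show "(c \<cdot>\<^sub>m A) $$ (i, j) = (c \<cdot>\<^sub>m A) $$ (j, i)"
    using ij symmetric_mats_dim[OF assms] symmetric_mats_swap[OF assms, of i j] by simp
qed

text \<open>An arbitrary orientation of the edges. It replaces the definite description in
  \<open>edge_value\<close> by an explicit pair of endpoints; symmetry makes the choice
  harmless.\<close>

definition edge_src :: "'a set \<Rightarrow> 'a" where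
  "edge_src e = (SOME u. u \<in> e)"

definition edge_tgt :: "'a set \<Rightarrow> 'a" where
  "edge_tgt e = (SOME v. v \<in> e \<and> v \<noteq> edge_src e)"

locale finite_simple_graph =
  fixes V :: "'a set" and E :: "'a set set"
  assumes graph: "simple_graph V E"
begin

lemma finite_V: "finite V"
  using graph by (simp add: simple_graph_def)

lemma finite_E: "finite E"
proof (rule finite_subset)
  show "E \<subseteq> Pow V"
    using graph by (auto simp: simple_graph_def)
qed (simp add: finite_V)

lemma edge_ends:
  assumes "e \<in> E"
  shows "e = {edge_src e, edge_tgt e}" "edge_src e \<noteq> edge_tgt e" "edge_src e \<in> V" "edge_tgt e \<in> V"
proof -
  have card: "card e = 2" and sub: "e \<subseteq> V"
    using graph assms by (auto simp: simple_graph_def)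
  obtain u v where uv: "e = {u, v}" "u \<noteq> v"
    using card by (auto simp: card_2_iff)
  have src: "edge_src e \<in> e"
    unfolding edge_src_def by (rule someI[of _ u]) (simp add: uv)
  then have "\<exists>w. w \<in> e \<and> w \<noteq> edge_src e"
    using uv by auto
  then have tgt: "edge_tgt e \<in> e \<and> edge_tgt e \<noteq> edge_src e"
    unfolding edge_tgt_def by (rule someI_ex)
  show "e = {edge_src e, edge_tgt e}" "edge_src e \<noteq> edge_tgt e" "edge_src e \<in> V" "edge_tgt e \<in> V"
    using src tgt uv sub by auto
qed

lemma edge_value_ends:
  assumes "e \<in> E" "F (x (edge_src e), x (edge_tgt e)) = F (x (edge_tgt e), x (edge_src e))"
  shows "edge_value F x e = F (x (edge_src e), x (edge_tgt e))"
  using edge_value_eq[of F x "edge_src e" "edge_tgt e"] assms edge_ends(1)[of e] by simp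

lemma hom_poly_eq:
  assumes A: "A \<in> symmetric_mats n"
  shows "hom_poly V E n A = (\<Sum>\<phi>\<in>V \<rightarrow>\<^sub>E {..<n}. \<Prod>e\<in>E. A $$ (\<phi> (edge_src e), \<phi> (edge_tgt e)))"
  unfolding hom_poly_def
proof (intro sum.cong prod.cong refl edge_value_ends)
  fix \<phi> e assume "\<phi> \<in> V \<rightarrow>\<^sub>E {..<n}" "e \<in> E"
  then show "A $$ (\<phi> (edge_src e), \<phi> (edge_tgt e)) = A $$ (\<phi> (edge_tgt e), \<phi> (edge_src e))"
    using edge_ends(3,4)[of e] by (intro symmetric_mats_swap[OF A]) auto
qed

lemma hom_poly_line:
  assumes A: "A \<in> symmetric_mats n" and B: "B \<in> symmetric_mats n"
  shows "\<exists>p. \<forall>t. hom_poly V E n (t \<cdot>\<^sub>m A + (1 - t) \<cdot>\<^sub>m B) = poly p t"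
proof -
  \<comment> \<open>The line is rewritten as B + t (A - B), with \<open>g\<close> from the base
    point and \<open>h\<close> from the direction.\<close>
  define g h where "g \<phi> e = B $$ (\<phi> (edge_src e), \<phi> (edge_tgt e))"
    and "h \<phi> e = A $$ (\<phi> (edge_src e), \<phi> (edge_tgt e)) - B $$ (\<phi> (edge_src e), \<phi> (edge_tgt e))"
    for \<phi> and e :: "'a set"
  have C: "t \<cdot>\<^sub>m A + (1 - t) \<cdot>\<^sub>m B \<in> symmetric_mats n" for t
    using A B by (intro symmetric_mats_add symmetric_mats_smult)
  have "hom_poly V E n (t \<cdot>\<^sub>m A + (1 - t) \<cdot>\<^sub>m B) =
      (\<Sum>\<phi>\<in>V \<rightarrow>\<^sub>E {..<n}. \<Prod>e\<in>E. g \<phi> e + t * h \<phi> e)" for t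
    unfolding hom_poly_eq[OF C]
  proof (intro sum.cong prod.cong refl)
    fix \<phi> e assume "\<phi> \<in> V \<rightarrow>\<^sub>E {..<n}" "e \<in> E"
    then have "\<phi> (edge_src e) < n" "\<phi> (edge_tgt e) < n"
      using edge_ends(3,4)[of e] by auto
    then show "(t \<cdot>\<^sub>m A + (1 - t) \<cdot>\<^sub>m B) $$ (\<phi> (edge_src e), \<phi> (edge_tgt e)) = g \<phi> e + t * h \<phi> e"
      using symmetric_mats_dim[OF A] symmetric_mats_dim[OF B] by (simp add: g_def h_def algebra_simps)
  qed
  also have "(\<Sum>\<phi>\<in>V \<rightarrow>\<^sub>E {..<n}. \<Prod>e\<in>E. g \<phi> e + t * h \<phi> e) =
      poly (\<Sum>\<phi>\<in>V \<rightarrow>\<^sub>E {..<n}. \<Sum>T\<in>Pow E. monom (prod (h \<phi>) T * prod (g \<phi>) (E - T)) (card T)) t" for t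
    by (simp add: prod_add_scaled[OF finite_E] poly_sum_Pow poly_sum[of _ "V \<rightarrow>\<^sub>E {..<n}"])
  finally show ?thesis
    by blast
qed

lemma hom_poly_scale:
  assumes A: "A \<in> symmetric_mats n"
  shows "hom_poly V E n (c \<cdot>\<^sub>m A) = c ^ card E * hom_poly V E n A"
proof -
  have C: "c \<cdot>\<^sub>m A \<in> symmetric_mats n"
    using A by (rule symmetric_mats_smult)
  have "hom_poly V E n (c \<cdot>\<^sub>m A) =
      (\<Sum>\<phi>\<in>V \<rightarrow>\<^sub>E {..<n}. \<Prod>e\<in>E. c * A $$ (\<phi> (edge_src e), \<phi> (edge_tgt e)))"
    unfolding hom_poly_eq[OF C]
  proof (intro sum.cong prod.cong refl)
    fix \<phi> e assume "\<phi> \<in> V \<rightarrow>\<^sub>E {..<n}" "e \<in> E"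
    then have "\<phi> (edge_src e) < n" "\<phi> (edge_tgt e) < n"
      using edge_ends(3,4)[of e] by auto
    then show "(c \<cdot>\<^sub>m A) $$ (\<phi> (edge_src e), \<phi> (edge_tgt e)) = c * A $$ (\<phi> (edge_src e), \<phi> (edge_tgt e))"
      using symmetric_mats_dim[OF A] by simp
  qed
  then show ?thesis
    by (simp add: hom_poly_eq[OF A] prod.distrib sum_distrib_left)
qed

lemma homogeneous_form_hom_poly:
  assumes "E \<noteq> {}"
  shows "homogeneous_form (symmetric_mats n) (+) (\<cdot>\<^sub>m) (0\<^sub>m n n) (=) (hom_poly V E n) (card E)"
proof
  show "0 < card E"
    using assms finite_E by (simp add: card_gt_0_iff)
  show "A = B" if A: "A \<in> symmetric_mats n" and B: "B \<in> symmetric_mats n"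
    and AB: "A + - 1 \<cdot>\<^sub>m B = 0\<^sub>m n n" for A B
  proof (rule eq_matI)
    note dims = symmetric_mats_dim[OF A] symmetric_mats_dim[OF B]
    fix i j assume "i < dim_row B" "j < dim_col B"
    then have "(A + - 1 \<cdot>\<^sub>m B) $$ (i, j) = A $$ (i, j) - B $$ (i, j)" "0\<^sub>m n n $$ (i, j) = (0 :: real)"
      using dims by simp_all
    then show "A $$ (i, j) = B $$ (i, j)"
      unfolding AB by simp
  qed (simp_all add: symmetric_mats_dim[OF A] symmetric_mats_dim[OF B])
qed (auto simp: symmetric_mats_dim symmetric_mats_add symmetric_mats_smult hom_poly_scale hom_poly_line
    algebra_simps intro: symmetric_matsI intro!: eq_matI)

text \<open>Flipping the colour of \<open>w\<close> multiplies the summand of a colouring by \<open>(- 1) ^ degree w\<close>.\<close>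

lemma odd_degree_hom_poly_eq_0:
  assumes w: "w \<in> V" and odd: "odd (card {e \<in> E. w \<in> e})"
  shows "hom_poly V E 2 (mat 2 2 (\<lambda>(i, j). if i = j then 1 else - 1)) = 0"
proof -
  define A :: "real mat" where "A = mat 2 2 (\<lambda>(i, j). if i = j then 1 else - 1)"
  have A: "A \<in> symmetric_mats 2"
    unfolding A_def by (rule symmetric_matsI) auto
  have A_ij: "A $$ (i, j) = (if i = j then 1 else - 1)" if "i < 2" "j < 2" for i j
    using that by (simp add: A_def)
  define F where "F \<phi> = (\<Prod>e\<in>E. A $$ (\<phi> (edge_src e), \<phi> (edge_tgt e)))" for \<phi>
  define flip where "flip \<phi> = \<phi>(w := 1 - \<phi> w)" for \<phi> :: "'a \<Rightarrow> nat"
  have flip_in: "flip \<phi> \<in> V \<rightarrow>\<^sub>E {..<2}" if "\<phi> \<in> V \<rightarrow>\<^sub>E {..<2}" for \<phi>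
    using that w by (auto simp: flip_def PiE_iff extensional_def)
  have flip_flip: "flip (flip \<phi>) = \<phi>" if "\<phi> \<in> V \<rightarrow>\<^sub>E {..<2}" for \<phi>
  proof -
    have "\<phi> w < 2"
      using that w by auto
    then show ?thesis
      by (auto simp: flip_def)
  qed
  have F_flip: "F (flip \<phi>) = - F \<phi>" if \<phi>: "\<phi> \<in> V \<rightarrow>\<^sub>E {..<2}" for \<phi>
  proof -
    have "F (flip \<phi>) = (\<Prod>e\<in>E. (if w \<in> e then - 1 else 1) * A $$ (\<phi> (edge_src e), \<phi> (edge_tgt e)))"
      unfolding F_def
    proof (intro prod.cong refl)
      fix e assume e: "e \<in> E"
      have lt: "\<phi> v < 2" "flip \<phi> v < 2" if "v \<in> V" for v
        using \<phi> flip_in[OF \<phi>] that by auto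
      note ends = edge_ends[OF e]
      have w_iff: "w \<in> e \<longleftrightarrow> w = edge_src e \<or> w = edge_tgt e"
        by (subst ends(1)) auto
      define i j where "i = \<phi> (edge_src e)" and "j = \<phi> (edge_tgt e)"
      have ij: "i = 0 \<or> i = 1" "j = 0 \<or> j = 1"
        using lt(1)[OF ends(3)] lt(1)[OF ends(4)] by (auto simp: i_def j_def)
      \<comment> \<open>As there are no loops, at most one endpoint of \<open>e\<close> is
        \<open>w\<close>: exactly one index changes when \<open>w \<in> e\<close>, and this reverses
        the sign of the entry.\<close>
      consider "w = edge_src e" | "w = edge_tgt e" | "w \<noteq> edge_src e" "w \<noteq> edge_tgt e"
        by blast
      then have "A $$ (flip \<phi> (edge_src e), flip \<phi> (edge_tgt e)) = (if w \<in> e then - 1 else 1) * A $$ (i, j)"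
      proof cases
        case 1
        then have "flip \<phi> (edge_src e) = 1 - i" "flip \<phi> (edge_tgt e) = j" "w \<in> e"
          using ends(2) w_iff by (auto simp: flip_def i_def j_def)
        then show ?thesis
          using ij by (auto simp: A_ij)
      next
        case 2
        then have "flip \<phi> (edge_src e) = i" "flip \<phi> (edge_tgt e) = 1 - j" "w \<in> e"
          using ends(2) w_iff by (auto simp: flip_def i_def j_def)
        then show ?thesis
          using ij by (auto simp: A_ij)
      next
        case 3
        then have "flip \<phi> (edge_src e) = i" "flip \<phi> (edge_tgt e) = j" "w \<notin> e"
          using w_iff by (auto simp: flip_def i_def j_def)
        then show ?thesis
          by simp
      qed
      then show "A $$ (flip \<phi> (edge_src e), flip \<phi> (edge_tgt e)) =
          (if w \<in> e then - 1 else 1) * A $$ (\<phi> (edge_src e), \<phi> (edge_tgt e))"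
        by (simp only: i_def j_def)
    qed
    also have "\<dots> = (\<Prod>e\<in>E. if w \<in> e then - 1 else 1) * F \<phi>"
      by (simp add: prod.distrib F_def)
    also have "(\<Prod>e\<in>E. if w \<in> e then - 1 else 1 :: real) = (- 1) ^ card {e \<in> E. w \<in> e}"
      by (simp add: prod.inter_filter[OF finite_E, symmetric])
    finally show ?thesis
      using odd by simp
  qed
  have "sum F (V \<rightarrow>\<^sub>E {..<2}) = (\<Sum>\<phi>\<in>V \<rightarrow>\<^sub>E {..<2}. F (flip \<phi>))"
    by (rule sum.reindex_bij_witness[of _ flip flip]) (auto simp: flip_in flip_flip)
  also have "\<dots> = - sum F (V \<rightarrow>\<^sub>E {..<2})"
    by (simp add: F_flip sum_negf)
  finally have "sum F (V \<rightarrow>\<^sub>E {..<2}) = 0"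
    by simp
  then show ?thesis
    using hom_poly_eq[OF A] by (simp add: F_def A_def)
qed

end

section \<open>Representing kernels by Borel functions\<close>

abbreviation unit_lborel :: "real measure" where
  "unit_lborel \<equiv> restrict_space lborel {0..1}"

lemma prob_space_unit_lborel: "prob_space unit_lborel"
  by (rule prob_spaceI) (simp add: space_restrict_space emeasure_restrict_space)

lemma measurable_unit_lborel_borel: "(\<lambda>x. x) \<in> unit_lborel \<rightarrow>\<^sub>M borel"
  by (simp add: measurable_restrict_space1)

interpretation U: prob_space unit_lborel
  by (rule prob_space_unit_lborel)

interpretation UU: pair_prob_space unit_lborel unit_lborel ..

interpretation PU: product_sigma_finite "\<lambda>_. unit_lborel" ..

lemma prob_space_PiM_unit_lborel: "prob_space (Pi\<^sub>M I (\<lambda>_. unit_lborel))"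
  by (intro prob_space_PiM prob_space_unit_lborel)

text \<open>The identity is measurable in both directions, so the sigma-algebras agree, and the
  measures agree on rectangles. Kernels on the square thereby become functions of two independent
  uniform points.\<close>

lemma pair_unit_lborel: "unit_lborel \<Otimes>\<^sub>M unit_lborel = restrict_space lborel unit_square"
proof (rule pair_measure_eqI)
  show "sigma_finite_measure unit_lborel" "sigma_finite_measure unit_lborel"
    by unfold_locales
  have 1: "(\<lambda>p. p) \<in> unit_lborel \<Otimes>\<^sub>M unit_lborel \<rightarrow>\<^sub>M restrict_space borel unit_square"
  proof (rule measurable_restrict_space2)
    have "(\<lambda>p. (fst p, snd p)) \<in> unit_lborel \<Otimes>\<^sub>M unit_lborel \<rightarrow>\<^sub>M borel \<Otimes>\<^sub>M borel"
      by (intro measurable_Pair measurable_compose[OF _ measurable_unit_lborel_borel]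
          measurable_fst measurable_snd)
    then show "(\<lambda>p. p) \<in> unit_lborel \<Otimes>\<^sub>M unit_lborel \<rightarrow>\<^sub>M borel"
      by (simp add: borel_prod)
  qed (auto simp: space_pair_measure)
  have 2: "(\<lambda>p. p) \<in> restrict_space borel unit_square \<rightarrow>\<^sub>M unit_lborel \<Otimes>\<^sub>M unit_lborel"
  proof -
    have "(\<lambda>p. (fst p, snd p)) \<in> restrict_space borel unit_square \<rightarrow>\<^sub>M unit_lborel \<Otimes>\<^sub>M unit_lborel"
      by (intro measurable_Pair measurable_restrict_space2)
        (auto simp: space_restrict_space
          intro!: measurable_restrict_space1 borel_measurable_continuous_onI continuous_intros)
    then show ?thesis
      by simp
  qed
  have sp: "space (unit_lborel \<Otimes>\<^sub>M unit_lborel) = unit_square"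
    "space (restrict_space borel unit_square) = unit_square"
    by (auto simp: space_pair_measure space_restrict_space)
  have "A \<in> sets (unit_lborel \<Otimes>\<^sub>M unit_lborel)" if "A \<in> sets (restrict_space borel unit_square)" for A
  proof -
    have "(\<lambda>p. p) -` A \<inter> unit_square = A"
      using sets.sets_into_space[OF that] sp by auto
    then show ?thesis
      using measurable_sets[OF 1 that] sp by simp
  qed
  moreover have "A \<in> sets (restrict_space borel unit_square)" if "A \<in> sets (unit_lborel \<Otimes>\<^sub>M unit_lborel)" for A
  proof -
    have "(\<lambda>p. p) -` A \<inter> unit_square = A"
      using sets.sets_into_space[OF that] sp by auto
    then show ?thesis
      using measurable_sets[OF 2 that] sp by simp
  qed
  ultimately have "sets (unit_lborel \<Otimes>\<^sub>M unit_lborel) = sets (restrict_space borel unit_square)"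
    by blast
  then show "sets (unit_lborel \<Otimes>\<^sub>M unit_lborel) = sets (restrict_space lborel unit_square)"
    by (simp cong: sets_restrict_space_cong)
  fix A B assume AB: "A \<in> sets unit_lborel" "B \<in> sets unit_lborel"
  then have sub: "A \<subseteq> {0..1}" "B \<subseteq> {0..1}" "A \<in> sets borel" "B \<in> sets borel"
    by (auto simp: sets_restrict_space)
  have "emeasure (restrict_space lborel unit_square) (A \<times> B) = emeasure lborel (A \<times> B)"
    using sub by (intro emeasure_restrict_space) (auto simp: borel_Times)
  also have "\<dots> = emeasure (lborel \<Otimes>\<^sub>M lborel) (A \<times> B)"
    by (simp add: lborel_prod)
  also have "\<dots> = emeasure lborel A * emeasure lborel B"
    using sub by (intro lborel.emeasure_pair_measure_Times) auto
  finally show "emeasure unit_lborel A * emeasure unit_lborel B =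
      emeasure (restrict_space lborel unit_square) (A \<times> B)"
    using sub by (simp add: emeasure_restrict_space)
qed

lemma kernel_eq_iff_AE: "kernel_eq U W \<longleftrightarrow> (AE p in unit_lborel \<Otimes>\<^sub>M unit_lborel. U p = W p)"
proof -
  have sq: "unit_square \<in> sets (borel :: (real \<times> real) measure)"
    by (simp add: borel_Times)
  show ?thesis
    unfolding kernel_eq_def pair_unit_lborel
    using sq by (subst (1 2) AE_restrict_space_iff) (auto simp: AE_completion_iff)
qed

text \<open>Symmetry and boundedness are imposed on the whole plane, so that products and sample
  matrices need no restriction to points of the square.\<close>

definition borel_kernels :: "(real \<times> real \<Rightarrow> real) set" where
  "borel_kernels =
     {W. W \<in> borel_measurable borel \<and> (\<forall>x y. W (x, y) = W (y, x)) \<and> bounded (range W)}"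

lemma borel_kernels_subset: "borel_kernels \<subseteq> bounded_kernels"
proof
  fix W assume W: "W \<in> borel_kernels"
  have "bounded (W ` unit_square)"
    using W by (auto simp: borel_kernels_def intro: bounded_subset)
  moreover have "W \<in> borel_measurable (lebesgue_on unit_square)"
    using W by (intro measurable_restrict_space1 measurable_completion) (auto simp: borel_kernels_def)
  ultimately show "W \<in> bounded_kernels"
    using W by (auto simp: borel_kernels_def bounded_kernels_def symmetric_kernel_def)
qed

lemma borel_kernel_bound:
  assumes "W \<in> borel_kernels"
  obtains b where "0 < b" "\<And>p. \<bar>W p\<bar> \<le> b"
  using assms bounded_pos[of "range W"] by (auto simp: borel_kernels_def)

text \<open>The kernel is extended by 0, replaced by a Borel version, truncated at its bound
  \<open>b\<close> and averaged with its transpose. None of this changes it on the square outside a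
  null set; for the averaging this uses that swapping coordinates preserves the measure.\<close>

lemma borel_kernel_representative:
  assumes W: "W \<in> bounded_kernels"
  obtains W' where "W' \<in> borel_kernels" "kernel_eq W W'"
proof -
  obtain b where b: "0 < b" "\<And>p. p \<in> unit_square \<Longrightarrow> \<bar>W p\<bar> \<le> b"
    using W bounded_pos[of "W ` unit_square"] unfolding bounded_kernels_def by auto
  have sq: "unit_square \<in> sets (borel :: (real \<times> real) measure)"
    by (simp add: borel_Times)
  have "(\<lambda>p. if p \<in> unit_square then W p else 0) \<in> borel_measurable lebesgue"
    using W sq by (subst measurable_restrict_space_iff[symmetric]) (auto simp: bounded_kernels_def)
  then obtain g where g: "g \<in> borel_measurable lborel"
    and g_eq: "AE p in lborel. (if p \<in> unit_square then W p else 0) = g p"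
    using completion_ex_borel_measurable_real by blast
  define h where "h p = max (- b) (min b (g p))" for p
  have h_meas: "h \<in> borel_measurable borel"
    using g unfolding h_def by measurable
  have h_eq: "AE p in unit_lborel \<Otimes>\<^sub>M unit_lborel. W p = h p"
    unfolding pair_unit_lborel using sq
  proof (subst AE_restrict_space_iff)
    show "AE p in lborel. p \<in> unit_square \<longrightarrow> W p = h p"
      using g_eq
    proof eventually_elim
      case (elim p)
      then show ?case
        using b(2)[of p] by (auto simp: h_def)
    qed
  qed auto
  define W' where "W' = (\<lambda>p. (h p + h (snd p, fst p)) / 2)"
  have swap: "(\<lambda>(x, y). (y, x)) \<in> unit_lborel \<Otimes>\<^sub>M unit_lborel \<rightarrow>\<^sub>M unit_lborel \<Otimes>\<^sub>M unit_lborel"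
    by measurable
  have "AE p in unit_lborel \<Otimes>\<^sub>M unit_lborel. W (case p of (x, y) \<Rightarrow> (y, x)) = h (case p of (x, y) \<Rightarrow> (y, x))"
    using h_eq by (intro AE_distrD[OF swap]) (subst UU.distr_pair_swap[symmetric])
  then have eq: "AE p in unit_lborel \<Otimes>\<^sub>M unit_lborel. W p = W' p"
    using h_eq AE_space
  proof eventually_elim
    case (elim p)
    obtain x y where p: "p = (x, y)"
      by (cases p)
    have "W (x, y) = W (y, x)"
      using elim(3) W by (auto simp: p space_pair_measure bounded_kernels_def symmetric_kernel_def)
    then show ?case
      using elim(1,2) by (simp add: p W'_def)
  qed
  have "W' \<in> borel_kernels"
  proof -
    have "(\<lambda>p. h (snd p, fst p)) \<in> borel_measurable borel"
    proof (rule measurable_compose[OF _ h_meas])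
      have "(\<lambda>p. (snd p, fst p)) \<in> (borel \<Otimes>\<^sub>M borel :: (real \<times> real) measure) \<rightarrow>\<^sub>M borel \<Otimes>\<^sub>M borel"
        by measurable
      then show "(\<lambda>p. (snd p, fst p)) \<in> (borel :: (real \<times> real) measure) \<rightarrow>\<^sub>M borel"
        by (simp add: borel_prod)
    qed
    then have "W' \<in> borel_measurable borel"
      unfolding W'_def using h_meas by measurable
    moreover have "\<bar>W' p\<bar> \<le> b" for p
      using b(1) by (auto simp: W'_def h_def)
    then have "bounded (range W')"
      by (intro boundedI[of _ b]) auto
    ultimately show ?thesis
      by (auto simp: borel_kernels_def W'_def)
  qed
  then show thesis
    using eq that kernel_eq_iff_AE by blast
qed

text \<open>The preimage of a rectangle is a cylinder over two different coordinates. This carries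
  null sets of the square to null sets of the cube, one edge at a time.\<close>

lemma distr_PiM_pair:
  assumes "u \<in> I" "v \<in> I" "u \<noteq> v"
  shows "distr (Pi\<^sub>M I (\<lambda>_. unit_lborel)) (unit_lborel \<Otimes>\<^sub>M unit_lborel) (\<lambda>x. (x u, x v)) =
    unit_lborel \<Otimes>\<^sub>M unit_lborel"
proof (rule pair_measure_eqI[symmetric])
  show "sigma_finite_measure unit_lborel" "sigma_finite_measure unit_lborel"
    by unfold_locales
  fix A B assume AB: "A \<in> sets unit_lborel" "B \<in> sets unit_lborel"
  define C where "C j = (if j = u then A else B)" for j
  let ?P = "Pi\<^sub>M I (\<lambda>_. unit_lborel)"
  have meas: "(\<lambda>x. (x u, x v)) \<in> ?P \<rightarrow>\<^sub>M unit_lborel \<Otimes>\<^sub>M unit_lborel"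
    using assms by measurable
  have "emeasure (distr ?P (unit_lborel \<Otimes>\<^sub>M unit_lborel) (\<lambda>x. (x u, x v))) (A \<times> B) =
      emeasure ?P ((\<lambda>x. (x u, x v)) -` (A \<times> B) \<inter> space ?P)"
    using meas AB by (intro emeasure_distr) auto
  also have "(\<lambda>x. (x u, x v)) -` (A \<times> B) \<inter> space ?P =
      prod_emb I (\<lambda>_. unit_lborel) {u, v} (Pi\<^sub>E {u, v} C)"
    using assms AB by (auto simp: prod_emb_def space_PiM C_def PiE_iff split: if_splits)
  also have "emeasure ?P \<dots> = (\<Prod>j\<in>{u, v}. emeasure unit_lborel (C j))"
    using assms AB by (intro emeasure_PiM_emb prob_space_unit_lborel) (auto simp: C_def)
  also have "\<dots> = emeasure unit_lborel A * emeasure unit_lborel B"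
    using assms by (simp add: C_def)
  finally show "emeasure unit_lborel A * emeasure unit_lborel B =
      emeasure (distr ?P (unit_lborel \<Otimes>\<^sub>M unit_lborel) (\<lambda>x. (x u, x v))) (A \<times> B)"
    by simp
qed simp

text \<open>Preimages under \<open>f\<close> and \<open>g\<close> differ by a subset of a null set,
  which the completion contains. The integrand of \<open>hom_density\<close> is measurable in this
  sense.\<close>

lemma measurable_completion_AE_eq:
  fixes f g :: "'b \<Rightarrow> real"
  assumes g: "g \<in> borel_measurable M" and eq: "AE x in M. f x = g x"
  shows "f \<in> borel_measurable (completion M)"
proof (rule measurableI)
  fix A :: "real set" assume A: "A \<in> sets borel"
  show "f -` A \<inter> space (completion M) \<in> sets (completion M)"
  proof (rule completion.in_sets_AE)
    show "g -` A \<inter> space M \<in> sets (completion M)"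
      using measurable_sets[OF g A] by auto
    have "AE x in completion M. f x = g x"
      using eq by (rule AE_completion)
    then show "AE x in completion M. x \<in> g -` A \<inter> space M \<longleftrightarrow> x \<in> f -` A \<inter> space (completion M)"
      by eventually_elim auto
  qed auto
qed auto

lemma integral_completion_AE_eq:
  fixes f g :: "'b \<Rightarrow> real"
  assumes g: "g \<in> borel_measurable M" and eq: "AE x in M. f x = g x"
  shows "integral\<^sup>L (completion M) f = integral\<^sup>L M g"
proof -
  have "integral\<^sup>L (completion M) f = integral\<^sup>L (completion M) g"
    using g eq by (intro integral_cong_AE measurable_completion_AE_eq[OF g] AE_completion)
      (auto intro: measurable_completion)
  then show ?thesis
    using g by (simp add: integral_completion)
qed

lemma measurable_kernel_PiM:
  assumes "W \<in> borel_measurable borel" "u \<in> I" "v \<in> I"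
  shows "(\<lambda>x. W (x u, x v)) \<in> borel_measurable (Pi\<^sub>M I (\<lambda>_. unit_lborel))"
proof (rule measurable_compose[OF _ assms(1)])
  have "(\<lambda>x. (x u, x v)) \<in> Pi\<^sub>M I (\<lambda>_. unit_lborel) \<rightarrow>\<^sub>M borel \<Otimes>\<^sub>M borel"
    using assms by (intro measurable_Pair measurable_compose[OF _ measurable_unit_lborel_borel]
        measurable_component_singleton)
  then show "(\<lambda>x. (x u, x v)) \<in> Pi\<^sub>M I (\<lambda>_. unit_lborel) \<rightarrow>\<^sub>M borel"
    by (simp add: borel_prod)
qed

context finite_simple_graph
begin

definition edge_prod :: "(real \<times> real \<Rightarrow> real) \<Rightarrow> ('a \<Rightarrow> real) \<Rightarrow> real" where
  "edge_prod W x = (\<Prod>e\<in>E. W (x (edge_src e), x (edge_tgt e)))"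

lemma measurable_edge_prod:
  assumes "W \<in> borel_kernels"
  shows "edge_prod W \<in> borel_measurable (Pi\<^sub>M V (\<lambda>_. unit_lborel))"
  unfolding edge_prod_def[abs_def] using assms edge_ends(3,4)
  by (intro borel_measurable_prod measurable_kernel_PiM) (auto simp: borel_kernels_def)

text \<open>Each of the finitely many edges excludes only a null set of points. The kernel is
  symmetric on the square alone, so \<open>AE_space\<close> is used to keep the coordinates in
  [0,1], where \<open>edge_value\<close> has its intended meaning.\<close>

lemma hom_density_eq_integral:
  assumes W: "W \<in> bounded_kernels" and W': "W' \<in> borel_kernels" and eq: "kernel_eq W W'"
  shows "hom_density V E W = (LINT x|Pi\<^sub>M V (\<lambda>_. unit_lborel). edge_prod W' x)"
  unfolding hom_density_def
proof (rule integral_completion_AE_eq[OF measurable_edge_prod[OF W']])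
  let ?P = "Pi\<^sub>M V (\<lambda>_. unit_lborel)"
  have "AE x in ?P. \<forall>e\<in>E. W (x (edge_src e), x (edge_tgt e)) = W' (x (edge_src e), x (edge_tgt e))"
  proof (rule AE_finite_allI[OF finite_E])
    fix e assume e: "e \<in> E"
    note ends = edge_ends[OF e]
    show "AE x in ?P. W (x (edge_src e), x (edge_tgt e)) = W' (x (edge_src e), x (edge_tgt e))"
    proof (rule AE_distrD[where f = "\<lambda>x. (x (edge_src e), x (edge_tgt e))"])
      show "(\<lambda>x. (x (edge_src e), x (edge_tgt e))) \<in> ?P \<rightarrow>\<^sub>M unit_lborel \<Otimes>\<^sub>M unit_lborel"
        using ends(3,4) by measurable
      show "AE p in distr ?P (unit_lborel \<Otimes>\<^sub>M unit_lborel) (\<lambda>x. (x (edge_src e), x (edge_tgt e))). W p = W' p"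
        unfolding distr_PiM_pair[OF ends(3,4,2)] using eq by (simp add: kernel_eq_iff_AE)
    qed
  qed
  then show "AE x in ?P. (\<Prod>e\<in>E. edge_value W x e) = edge_prod W' x"
    using AE_space
  proof eventually_elim
    case (elim x)
    have "edge_value W x e = W' (x (edge_src e), x (edge_tgt e))" if e: "e \<in> E" for e
    proof -
      have "W (x (edge_src e), x (edge_tgt e)) = W (x (edge_tgt e), x (edge_src e))"
        using elim(2) edge_ends(3,4)[OF e] W
        by (auto simp: space_PiM PiE_iff bounded_kernels_def symmetric_kernel_def)
      then show ?thesis
        using edge_value_ends[OF e, of W x] elim(1) e by simp
    qed
    then show ?case
      by (simp add: edge_prod_def)
  qed
qed

end

section \<open>Sampling\<close>

lemma injective_maps_ratio:
  assumes "finite V"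
  shows "(\<lambda>n. real (card {\<phi> \<in> V \<rightarrow>\<^sub>E {..<n}. inj_on \<phi> V}) / real n ^ card V) \<longlonglongrightarrow> 1"
proof -
  \<comment> \<open>The product is the falling factorial counting injections, divided factor by
    factor. For \<open>n < card V\<close> the factor with i = n vanishes, as does the count.\<close>
  have "(\<lambda>n. \<Prod>i\<in>{0..<card V}. real (n - i) / real n) \<longlonglongrightarrow> (\<Prod>i\<in>{0..<card V}. 1)"
    by (rule tendsto_prod) real_asymp
  moreover have "(\<Prod>i\<in>{0..<card V}. real (n - i) / real n) =
      real (card {\<phi> \<in> V \<rightarrow>\<^sub>E {..<n}. inj_on \<phi> V}) / real n ^ card V" for n
    using card_inj_on_subset_funcset[OF assms finite_lessThan[of n] subset_refl]
    by (simp add: prod_dividef)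
  ultimately show ?thesis
    by simp
qed

text \<open>A colouring \<open>\<phi>\<close> that is injective on \<open>V\<close> turns \<open>n\<close> independent points into \<open>card V\<close> independent
  points, and almost all colourings with \<open>n\<close> colours are injective.\<close>

lemma sampling_limit:
  fixes F :: "('a \<Rightarrow> real) \<Rightarrow> real"
  assumes V: "finite V" and F: "F \<in> borel_measurable (Pi\<^sub>M V (\<lambda>_. unit_lborel))"
    and bound: "\<And>x. \<bar>F x\<bar> \<le> B"
  shows "(\<lambda>n. (\<Sum>\<phi>\<in>V \<rightarrow>\<^sub>E {..<n}. LINT x|Pi\<^sub>M {..<n} (\<lambda>_. unit_lborel). F (\<lambda>v\<in>V. x (\<phi> v))) / real n ^ card V)
    \<longlonglongrightarrow> (LINT x|Pi\<^sub>M V (\<lambda>_. unit_lborel). F x)"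
    (is "(\<lambda>n. ?s n) \<longlonglongrightarrow> ?I")
proof (rule LIM_zero_cancel, rule Lim_null_comparison)
  let ?P = "\<lambda>I. Pi\<^sub>M I (\<lambda>_. unit_lborel)"
  define T where "T n \<phi> = (LINT x|?P {..<n}. F (\<lambda>v\<in>V. x (\<phi> v)))" for n :: nat and \<phi>
  \<comment> \<open>A function that is not integrable has integral 0, so the bound holds for every
    pointwise bounded \<open>f\<close>, with no measurability argument per colouring.\<close>
  have abs_le: "\<bar>integral\<^sup>L M f\<bar> \<le> B" if "prob_space M" "\<And>x. \<bar>f x\<bar> \<le> B" for M :: "'c measure" and f :: "'c \<Rightarrow> real"
  proof -
    interpret M: prob_space M by fact
    have "0 \<le> B"
      using that(2)[of undefined] by linarith
    have "\<bar>integral\<^sup>L M f\<bar> \<le> (\<integral>x. B \<partial>M)"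
    proof (cases "integrable M f")
      case True
      have "\<bar>integral\<^sup>L M f\<bar> \<le> (\<integral>x. \<bar>f x\<bar> \<partial>M)"
        by (rule integral_abs_bound)
      also have "\<dots> \<le> (\<integral>x. B \<partial>M)"
        using True that(2) by (intro integral_mono) auto
      finally show ?thesis .
    next
      case False
      then show ?thesis
        using \<open>0 \<le> B\<close> by (simp add: not_integrable_integral_eq)
    qed
    then show ?thesis
      by (simp add: M.prob_space)
  qed
  have T_inj: "T n \<phi> = ?I" if \<phi>: "\<phi> \<in> V \<rightarrow>\<^sub>E {..<n}" "inj_on \<phi> V" for n \<phi>
  proof -
    have meas: "(\<lambda>x. \<lambda>v\<in>V. x (\<phi> v)) \<in> ?P {..<n} \<rightarrow>\<^sub>M ?P V"
      using \<phi> by (intro measurable_restrict measurable_component_singleton) auto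
    have "?I = integral\<^sup>L (distr (?P {..<n}) (?P V) (\<lambda>x. \<lambda>v\<in>V. x (\<phi> v))) F"
      using \<phi> by (subst distr_PiM_reindex) (auto intro: prob_space_unit_lborel)
    also have "\<dots> = T n \<phi>"
      unfolding T_def by (rule integral_distr[OF meas F])
    finally show ?thesis
      by simp
  qed
  have T_le: "\<bar>T n \<phi> - ?I\<bar> \<le> 2 * B" for n \<phi>
    using abs_le[OF prob_space_PiM_unit_lborel, of "\<lambda>x. F (\<lambda>v\<in>V. x (\<phi> v))" "{..<n}"]
      abs_le[OF prob_space_PiM_unit_lborel, of F V] bound
    unfolding T_def by fastforce
  let ?inj = "\<lambda>n. {\<phi> \<in> V \<rightarrow>\<^sub>E {..<n}. inj_on \<phi> V}"
  \<comment> \<open>Injective colourings contribute exactly the limit value; each of the others errs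
    by at most 2 B.\<close>
  show "\<forall>\<^sub>F n in sequentially. norm (?s n - ?I) \<le> 2 * B * (1 - real (card (?inj n)) / real n ^ card V)"
    using eventually_gt_at_top[of 0]
  proof eventually_elim
    case (elim n)
    have fin: "finite (V \<rightarrow>\<^sub>E {..<n})"
      using V by (intro finite_PiE) auto
    have card: "real (card (V \<rightarrow>\<^sub>E {..<n})) = real n ^ card V"
      using V by (simp add: card_funcsetE)
    have pos: "0 < real n ^ card V"
      using elim by simp
    have "?s n - ?I = (\<Sum>\<phi>\<in>V \<rightarrow>\<^sub>E {..<n}. T n \<phi> - ?I) / real n ^ card V"
      using pos by (simp add: sum_subtractf card T_def[symmetric] diff_divide_distrib)
    also have "(\<Sum>\<phi>\<in>V \<rightarrow>\<^sub>E {..<n}. T n \<phi> - ?I) = (\<Sum>\<phi>\<in>(V \<rightarrow>\<^sub>E {..<n}) - ?inj n. T n \<phi> - ?I)"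
      using fin T_inj by (intro sum.mono_neutral_right) auto
    finally have "norm (?s n - ?I) = \<bar>\<Sum>\<phi>\<in>(V \<rightarrow>\<^sub>E {..<n}) - ?inj n. T n \<phi> - ?I\<bar> / real n ^ card V"
      by (simp only: real_norm_def abs_divide) (use pos in simp)
    also have "\<dots> \<le> (real (card ((V \<rightarrow>\<^sub>E {..<n}) - ?inj n)) * (2 * B)) / real n ^ card V"
      using pos T_le by (intro divide_right_mono order.trans[OF sum_abs] sum_bounded_above) auto
    also have "real (card ((V \<rightarrow>\<^sub>E {..<n}) - ?inj n)) = real n ^ card V - real (card (?inj n))"
      using card_Diff_subset[of "?inj n" "V \<rightarrow>\<^sub>E {..<n}"] card_mono[OF fin, of "?inj n"] fin
      by (simp add: of_nat_diff flip: card)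
    also have "(real n ^ card V - real (card (?inj n))) * (2 * B) / real n ^ card V =
        2 * B * (1 - real (card (?inj n)) / real n ^ card V)"
      using pos by (simp add: field_simps)
    finally show ?case .
  qed
  have "(\<lambda>n. 2 * B * (1 - real (card (?inj n)) / real n ^ card V)) \<longlonglongrightarrow> 2 * B * (1 - 1)"
    by (intro tendsto_intros injective_maps_ratio V)
  then show "(\<lambda>n. 2 * B * (1 - real (card (?inj n)) / real n ^ card V)) \<longlonglongrightarrow> 0"
    by simp
qed

section \<open>Matrices sampled from a kernel\<close>

lemma borel_kernels_lin:
  assumes U: "U \<in> borel_kernels" and W: "W \<in> borel_kernels"
  shows "(\<lambda>p. a * U p + b * W p) \<in> borel_kernels"
proof -
  obtain c d where "\<And>p. \<bar>U p\<bar> \<le> c" "\<And>p. \<bar>W p\<bar> \<le> d"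
    using borel_kernel_bound[OF U] borel_kernel_bound[OF W] by metis
  then have "\<bar>a * U p + b * W p\<bar> \<le> \<bar>a\<bar> * c + \<bar>b\<bar> * d" for p
    by (intro order.trans[OF abs_triangle_ineq] add_mono) (auto simp: abs_mult mult_left_mono)
  then have "bounded (range (\<lambda>p. a * U p + b * W p))"
    by (intro boundedI[of _ "\<bar>a\<bar> * c + \<bar>b\<bar> * d"]) auto
  then show ?thesis
    using U W by (auto simp: borel_kernels_def)
qed

text \<open>The diagonal is filled with the values W (x i, x i), although the diagonal of the square
  is a null set. Only colourings that identify adjacent vertices read these entries, and such
  colourings are negligible in the limit.\<close>

definition sample_mat :: "(real \<times> real \<Rightarrow> real) \<Rightarrow> nat \<Rightarrow> (nat \<Rightarrow> real) \<Rightarrow> real mat" where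
  "sample_mat W n x = mat n n (\<lambda>(i, j). W (x i, x j))"

lemma sample_mat_symmetric:
  assumes "W \<in> borel_kernels"
  shows "sample_mat W n x \<in> symmetric_mats n"
  using assms by (intro symmetric_matsI) (auto simp: sample_mat_def borel_kernels_def)

lemma sample_mat_lin:
  "sample_mat (\<lambda>p. a * U p + b * W p) n x = a \<cdot>\<^sub>m sample_mat U n x + b \<cdot>\<^sub>m sample_mat W n x"
  by (auto simp: sample_mat_def intro!: eq_matI)

context finite_simple_graph
begin

definition kernel_density :: "(real \<times> real \<Rightarrow> real) \<Rightarrow> real" where
  "kernel_density W = (LINT x|Pi\<^sub>M V (\<lambda>_. unit_lborel). edge_prod W x)"

lemma edge_prod_bounded:
  assumes "W \<in> borel_kernels"
  obtains B where "0 \<le> B" "\<And>x. \<bar>edge_prod W x\<bar> \<le> B"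
proof -
  obtain b where b: "\<And>p. \<bar>W p\<bar> \<le> b"
    using borel_kernel_bound[OF assms] by metis
  have "\<bar>edge_prod W x\<bar> \<le> (\<Prod>e\<in>E. b)" for x
    unfolding edge_prod_def abs_prod using b by (intro prod_mono) auto
  then show thesis
    using that[of "\<Prod>e\<in>E. b"] by (meson order.trans abs_ge_zero)
qed

lemma hom_poly_sample_mat:
  assumes "W \<in> borel_kernels"
  shows "hom_poly V E n (sample_mat W n x) = (\<Sum>\<phi>\<in>V \<rightarrow>\<^sub>E {..<n}. edge_prod W (\<lambda>v\<in>V. x (\<phi> v)))"
  unfolding hom_poly_eq[OF sample_mat_symmetric[OF assms]] edge_prod_def
proof (intro sum.cong prod.cong refl)
  fix \<phi> e assume \<phi>: "\<phi> \<in> V \<rightarrow>\<^sub>E {..<n}" and e: "e \<in> E"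
  note ends = edge_ends(3,4)[OF e]
  have "\<phi> (edge_src e) < n" "\<phi> (edge_tgt e) < n"
    using \<phi> ends by auto
  then show "sample_mat W n x $$ (\<phi> (edge_src e), \<phi> (edge_tgt e)) =
      W ((\<lambda>v\<in>V. x (\<phi> v)) (edge_src e), (\<lambda>v\<in>V. x (\<phi> v)) (edge_tgt e))"
    using ends by (simp add: sample_mat_def)
qed

lemma integrable_edge_prod_sample:
  assumes W: "W \<in> borel_kernels" and \<phi>: "\<phi> \<in> V \<rightarrow>\<^sub>E {..<n}"
  shows "integrable (Pi\<^sub>M {..<n} (\<lambda>_. unit_lborel)) (\<lambda>x. edge_prod W (\<lambda>v\<in>V. x (\<phi> v)))"
proof -
  interpret prob_space "Pi\<^sub>M {..<n} (\<lambda>_. unit_lborel)"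
    by (rule prob_space_PiM_unit_lborel)
  obtain B where "\<And>x. \<bar>edge_prod W x\<bar> \<le> B"
    using edge_prod_bounded[OF W] by metis
  moreover have "(\<lambda>x. edge_prod W (\<lambda>v\<in>V. x (\<phi> v))) \<in> borel_measurable (Pi\<^sub>M {..<n} (\<lambda>_. unit_lborel))"
    using \<phi> by (intro measurable_compose[OF _ measurable_edge_prod[OF W]] measurable_restrict
        measurable_component_singleton) auto
  ultimately show ?thesis
    by (intro integrable_const_bound[where B = B]) auto
qed

lemma integrable_hom_poly_sample:
  assumes W: "W \<in> borel_kernels"
  shows "integrable (Pi\<^sub>M {..<n} (\<lambda>_. unit_lborel)) (\<lambda>x. hom_poly V E n (sample_mat W n x))"
  unfolding hom_poly_sample_mat[OF W]
  by (intro Bochner_Integration.integrable_sum integrable_edge_prod_sample[OF W])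

lemma kernel_density_sampling_limit:
  assumes W: "W \<in> borel_kernels"
  shows "(\<lambda>n. (LINT x|Pi\<^sub>M {..<n} (\<lambda>_. unit_lborel). hom_poly V E n (sample_mat W n x)) / real n ^ card V)
    \<longlonglongrightarrow> kernel_density W"
proof -
  obtain B where "\<And>x. \<bar>edge_prod W x\<bar> \<le> B"
    using edge_prod_bounded[OF W] by metis
  then show ?thesis
    using sampling_limit[OF finite_V measurable_edge_prod[OF W], of B]
    unfolding hom_poly_sample_mat[OF W] kernel_density_def
    by (simp add: Bochner_Integration.integral_sum integrable_edge_prod_sample[OF W])
qed

lemma kernel_density_nonneg:
  assumes "\<And>n A. A \<in> symmetric_mats n \<Longrightarrow> 0 \<le> hom_poly V E n A" and W: "W \<in> borel_kernels"
  shows "0 \<le> kernel_density W"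
  by (rule LIMSEQ_le_const[OF kernel_density_sampling_limit[OF W]])
    (auto intro!: exI[of _ 0] divide_nonneg_nonneg Bochner_Integration.integral_nonneg assms(1)
      sample_mat_symmetric[OF W])

text \<open>At fixed sample points the matrix depends linearly on the kernel, so the matrix
  inequality holds pointwise and survives integration and the limit.\<close>

lemma kernel_density_convex:
  assumes conv: "\<And>n A B. A \<in> symmetric_mats n \<Longrightarrow> B \<in> symmetric_mats n \<Longrightarrow>
      hom_poly V E n (c \<cdot>\<^sub>m A + (1 - c) \<cdot>\<^sub>m B) \<le> c * hom_poly V E n A + (1 - c) * hom_poly V E n B"
    and U: "U \<in> borel_kernels" and W: "W \<in> borel_kernels"
  shows "kernel_density (\<lambda>p. c * U p + (1 - c) * W p) \<le> c * kernel_density U + (1 - c) * kernel_density W"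
proof (rule LIMSEQ_le)
  let ?L = "\<lambda>n W. LINT x|Pi\<^sub>M {..<n} (\<lambda>_. unit_lborel). hom_poly V E n (sample_mat W n x)"
  let ?X = "\<lambda>p. c * U p + (1 - c) * W p"
  have X: "?X \<in> borel_kernels"
    using U W by (rule borel_kernels_lin)
  show "(\<lambda>n. ?L n ?X / real n ^ card V) \<longlonglongrightarrow> kernel_density ?X"
    by (rule kernel_density_sampling_limit[OF X])
  show "(\<lambda>n. c * (?L n U / real n ^ card V) + (1 - c) * (?L n W / real n ^ card V)) \<longlonglongrightarrow>
      c * kernel_density U + (1 - c) * kernel_density W"
    by (intro tendsto_intros kernel_density_sampling_limit U W)
  have "?L n ?X \<le> c * ?L n U + (1 - c) * ?L n W" for n
  proof -
    have "?L n ?X \<le> (LINT x|Pi\<^sub>M {..<n} (\<lambda>_. unit_lborel).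
        c * hom_poly V E n (sample_mat U n x) + (1 - c) * hom_poly V E n (sample_mat W n x))"
      using conv sample_mat_symmetric U W unfolding sample_mat_lin
      by (intro integral_mono) (auto intro!: integrable_hom_poly_sample[OF X, unfolded sample_mat_lin]
          integrable_hom_poly_sample)
    also have "\<dots> = c * ?L n U + (1 - c) * ?L n W"
      by (subst Bochner_Integration.integral_add) (auto intro!: integrable_hom_poly_sample U W)
    finally show ?thesis .
  qed
  then have "?L n ?X / real n ^ card V \<le> c * (?L n U / real n ^ card V) + (1 - c) * (?L n W / real n ^ card V)" for n
    using divide_right_mono[of "?L n ?X" "c * ?L n U + (1 - c) * ?L n W" "real n ^ card V"]
    by (simp add: add_divide_distrib)
  then show "\<exists>N. \<forall>n\<ge>N. ?L n ?X / real n ^ card V \<le>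
      c * (?L n U / real n ^ card V) + (1 - c) * (?L n W / real n ^ card V)"
    by blast
qed

text \<open>The edges in \<open>T\<close> carry \<open>W\<close> and the others \<open>U\<close>.
  These are the coefficients of the density of U + t W; singletons \<open>T\<close> give the term
  linear in t.\<close>

definition mixed_density :: "(real \<times> real \<Rightarrow> real) \<Rightarrow> (real \<times> real \<Rightarrow> real) \<Rightarrow> 'a set set \<Rightarrow> real" where
  "mixed_density U W T = (LINT x|Pi\<^sub>M V (\<lambda>_. unit_lborel).
     (\<Prod>e\<in>T. W (x (edge_src e), x (edge_tgt e))) * (\<Prod>e\<in>E - T. U (x (edge_src e), x (edge_tgt e))))"

lemma integrable_mixed:
  assumes U: "U \<in> borel_kernels" and W: "W \<in> borel_kernels" and T: "T \<subseteq> E"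
  shows "integrable (Pi\<^sub>M V (\<lambda>_. unit_lborel)) (\<lambda>x. (\<Prod>e\<in>T. W (x (edge_src e), x (edge_tgt e))) *
    (\<Prod>e\<in>E - T. U (x (edge_src e), x (edge_tgt e))))" (is "integrable ?P ?f")
proof -
  interpret prob_space ?P
    by (rule prob_space_PiM_unit_lborel)
  obtain c d where cd: "\<And>p. \<bar>U p\<bar> \<le> c" "\<And>p. \<bar>W p\<bar> \<le> d"
    using borel_kernel_bound[OF U] borel_kernel_bound[OF W] by metis
  have "\<bar>?f x\<bar> \<le> (\<Prod>e\<in>T. d) * (\<Prod>e\<in>E - T. c)" for x
    unfolding abs_mult abs_prod using cd order.trans[OF abs_ge_zero cd(2)]
    by (intro mult_mono prod_mono prod_nonneg conjI) auto
  moreover have "?f \<in> borel_measurable ?P"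
    using U W T edge_ends(3,4)
    by (intro borel_measurable_times borel_measurable_prod measurable_kernel_PiM)
      (auto simp: borel_kernels_def)
  ultimately show ?thesis
    by (intro integrable_const_bound[where B = "(\<Prod>e\<in>T. d) * (\<Prod>e\<in>E - T. c)"]) auto
qed

lemma kernel_density_line:
  assumes U: "U \<in> borel_kernels" and W: "W \<in> borel_kernels"
  shows "kernel_density (\<lambda>p. U p + t * W p) = (\<Sum>T\<in>Pow E. t ^ card T * mixed_density U W T)"
proof -
  have "kernel_density (\<lambda>p. U p + t * W p) = (LINT x|Pi\<^sub>M V (\<lambda>_. unit_lborel). (\<Sum>T\<in>Pow E. t ^ card T *
      ((\<Prod>e\<in>T. W (x (edge_src e), x (edge_tgt e))) * (\<Prod>e\<in>E - T. U (x (edge_src e), x (edge_tgt e))))))"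
    unfolding kernel_density_def edge_prod_def prod_add_scaled[OF finite_E] ..
  also have "\<dots> = (\<Sum>T\<in>Pow E. t ^ card T * mixed_density U W T)"
    unfolding mixed_density_def
    by (subst Bochner_Integration.integral_sum) (auto intro!: integrable_mixed U W)
  finally show ?thesis .
qed

lemma kernel_density_scale: "kernel_density (\<lambda>p. c * W p) = c ^ card E * kernel_density W"
  unfolding kernel_density_def edge_prod_def by (simp add: prod.distrib)

end

section \<open>Kernels of density zero\<close>

definition square_kernel :: "real set \<Rightarrow> real \<times> real \<Rightarrow> real" where
  "square_kernel S = (\<lambda>p. indicator S (fst p) * indicator S (snd p))"

lemma borel_measurable_rectangle:
  assumes "A \<in> sets borel" "B \<in> sets borel"
  shows "(\<lambda>p. indicator A (fst p) * indicator B (snd p) :: real) \<in> borel_measurable (borel :: (real \<times> real) measure)"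
proof -
  have "(\<lambda>p. indicator A (fst p) * indicator B (snd p) :: real) \<in>
      borel_measurable (borel \<Otimes>\<^sub>M borel :: (real \<times> real) measure)"
    using assms by measurable
  then show ?thesis
    by (simp add: borel_prod)
qed

lemma square_kernel_in_borel_kernels:
  assumes "S \<in> sets borel"
  shows "square_kernel S \<in> borel_kernels"
proof -
  have "bounded (range (square_kernel S))"
    by (intro boundedI[of _ 1]) (auto simp: square_kernel_def indicator_def)
  then show ?thesis
    using borel_measurable_rectangle[OF assms assms] by (auto simp: borel_kernels_def square_kernel_def)
qed

lemma measurable_pair_unit_lborel:
  assumes "f \<in> borel_measurable borel"
  shows "f \<in> borel_measurable (unit_lborel \<Otimes>\<^sub>M unit_lborel)"
  using assms unfolding pair_unit_lborel by (intro measurable_restrict_space1) simp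

lemma integrable_kernel_rectangle:
  assumes W: "W \<in> borel_kernels" and AB: "A \<in> sets borel" "B \<in> sets borel"
  shows "integrable (unit_lborel \<Otimes>\<^sub>M unit_lborel) (\<lambda>p. W p * (indicator A (fst p) * indicator B (snd p)))"
proof -
  obtain b where b: "0 < b" "\<And>p. \<bar>W p\<bar> \<le> b"
    using borel_kernel_bound[OF W] by metis
  have "\<bar>W p * (indicator A (fst p) * indicator B (snd p))\<bar> \<le> b" for p
    using b by (auto simp: indicator_def less_imp_le)
  moreover have "(\<lambda>p. W p * (indicator A (fst p) * indicator B (snd p))) \<in>
      borel_measurable (unit_lborel \<Otimes>\<^sub>M unit_lborel)"
    using W AB by (intro measurable_pair_unit_lborel borel_measurable_times borel_measurable_rectangle)
      (auto simp: borel_kernels_def)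
  ultimately show ?thesis
    by (intro UU.P.integrable_const_bound[where B = b]) auto
qed

lemma integral_rectangles_zero:
  assumes W: "W \<in> borel_kernels"
    and sq: "\<And>S. S \<in> sets borel \<Longrightarrow> (LINT p|(unit_lborel \<Otimes>\<^sub>M unit_lborel). W p * square_kernel S p) = 0"
    and AB: "A \<in> sets borel" "B \<in> sets borel"
  shows "(LINT p|(unit_lborel \<Otimes>\<^sub>M unit_lborel). W p * (indicator A (fst p) * indicator B (snd p))) = 0"
    (is "?I A B = 0")
proof -
  let ?L = "integral\<^sup>L (unit_lborel \<Otimes>\<^sub>M unit_lborel)"
  let ?q = "\<lambda>S p. W p * square_kernel S p"
  have int: "integrable (unit_lborel \<Otimes>\<^sub>M unit_lborel) (?q S)" if "S \<in> sets borel" for S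
    using integrable_kernel_rectangle[OF W that that] by (simp add: square_kernel_def)
  have swap: "?I B A = ?I A B"
  proof -
    have "(\<integral>(x, y). W (y, x) * (indicator A y * indicator B x) \<partial>(unit_lborel \<Otimes>\<^sub>M unit_lborel)) = ?I A B"
      using UU.integral_product_swap[OF borel_measurable_integrable[OF integrable_kernel_rectangle[OF W AB]]]
      by simp
    moreover have "W (y, x) = W (x, y)" for x y
      using W by (simp add: borel_kernels_def)
    then have "?I B A = (\<integral>(x, y). W (y, x) * (indicator A y * indicator B x) \<partial>(unit_lborel \<Otimes>\<^sub>M unit_lborel))"
      by (intro Bochner_Integration.integral_cong refl) (auto simp: mult.commute)
    ultimately show ?thesis
      by simp
  qed
  define D where "D = (A - B) \<union> (B - A)"
  have sets: "A \<union> B \<in> sets borel" "A \<inter> B \<in> sets borel" "D \<in> sets borel"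
    using AB by (auto simp: D_def)
  have "?I A B + ?I B A = ?L (\<lambda>p. W p * (indicator A (fst p) * indicator B (snd p)) +
      W p * (indicator B (fst p) * indicator A (snd p)))"
    using integrable_kernel_rectangle[OF W] AB by simp
  \<comment> \<open>The parallelogram law for tensor squares: the indicators of the union and the
    intersection have the sum 1_A + 1_B and the difference 1_D. Removing the squares of A and B
    leaves the two mixed terms, which symmetry of \<open>W\<close> makes equal.\<close>
  also have "\<dots> = ?L (\<lambda>p. 2 * ?q (A \<union> B) p + 2 * ?q (A \<inter> B) p - ?q D p - ?q A p - ?q B p)"
    by (intro Bochner_Integration.integral_cong refl)
      (auto simp: square_kernel_def D_def indicator_def algebra_simps)
  also have "\<dots> = 0"
    using int[OF sets(1)] int[OF sets(2)] int[OF sets(3)] int[OF AB(1)] int[OF AB(2)]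
      sq[OF sets(1)] sq[OF sets(2)] sq[OF sets(3)] sq[OF AB(1)] sq[OF AB(2)] by simp
  finally show ?thesis
    using swap by simp
qed

text \<open>Rectangles form an intersection-stable generator, and the sets over which
  \<open>W\<close> integrates to 0 are closed under complements and countable disjoint unions. So
  all measurable sets qualify, and \<open>W\<close> vanishes almost everywhere.\<close>

lemma kernel_zero_of_rectangles:
  assumes W: "W \<in> borel_kernels"
    and rect: "\<And>A B. A \<in> sets borel \<Longrightarrow> B \<in> sets borel \<Longrightarrow>
      (LINT p|(unit_lborel \<Otimes>\<^sub>M unit_lborel). W p * (indicator A (fst p) * indicator B (snd p))) = 0"
  shows "kernel_eq W (\<lambda>p. 0)"
  unfolding kernel_eq_iff_AE
proof (rule density_unique_real)
  let ?UU = "unit_lborel \<Otimes>\<^sub>M unit_lborel"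
  show int: "integrable ?UU W"
    using integrable_kernel_rectangle[OF W, of UNIV UNIV] by simp
  have set_int: "set_integrable ?UU C W" if "C \<in> sets ?UU" for C
    unfolding set_integrable_def using int that by (intro integrable_mult_indicator)
  fix C assume "C \<in> sets ?UU"
  then have "C \<in> sigma_sets (space unit_lborel \<times> space unit_lborel)
      {a \<times> b |a b. a \<in> sets unit_lborel \<and> b \<in> sets unit_lborel}"
    by (simp add: sets_pair_measure)
  with Int_stable_pair_measure_generator pair_measure_closed
  have "(LINT p:C|?UU. W p) = 0"
  proof (induction rule: sigma_sets_induct_disjoint)
    case (basic C)
    then obtain A B where AB: "C = A \<times> B" "A \<in> sets borel" "B \<in> sets borel"
      by (auto simp: sets_restrict_space)
    have "(LINT p:C|?UU. W p) = (LINT p|?UU. W p * (indicator A (fst p) * indicator B (snd p)))"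
      unfolding set_lebesgue_integral_def AB(1)
      by (intro Bochner_Integration.integral_cong) (auto simp: indicator_def)
    then show ?case
      using rect[OF AB(2,3)] by simp
  next
    case empty
    show ?case
      by (simp add: set_lebesgue_integral_def)
  next
    case (compl C)
    let ?X = "space unit_lborel \<times> space unit_lborel"
    have C: "C \<in> sets ?UU"
      using compl(1) by (simp add: sets_pair_measure)
    have X: "?X \<in> sets ?UU"
      by (intro pair_measureI sets.top)
    have "(LINT p:?X|?UU. W p) = (LINT p|?UU. W p * (indicator {0..1} (fst p) * indicator {0..1} (snd p)))"
      unfolding set_lebesgue_integral_def
      by (intro Bochner_Integration.integral_cong) (auto simp: indicator_def)
    then have "(LINT p:?X|?UU. W p) = 0"
      using rect[of "{0..1}" "{0..1}"] by simp
    moreover have "(LINT p:(?X - C) \<union> C|?UU. W p) = (LINT p:?X - C|?UU. W p) + (LINT p:C|?UU. W p)"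
      using C X by (intro set_integral_Un set_int) auto
    moreover have "(?X - C) \<union> C = ?X"
      using sets.sets_into_space[OF C] by (auto simp: space_pair_measure)
    ultimately show ?case
      using compl(2) by simp
  next
    case (union C)
    have C: "C i \<in> sets ?UU" for i
      using union(2) by (auto simp: sets_pair_measure)
    have "(LINT p:(\<Union>i. C i)|?UU. W p) = (\<Sum>i. LINT p:C i|?UU. W p)"
      using C union(1) by (intro lebesgue_integral_countable_add set_int) (auto simp: disjoint_family_on_def)
    then show ?case
      using union(3) by simp
  qed
  then show "(LINT p:C|?UU. W p) = (LINT p:C|?UU. 0)"
    by simp
qed simp

context finite_simple_graph
begin

text \<open>By \<open>cover\<close>, deleting \<open>e\<close> uncovers no vertex, so the remaining
  product still says that all non-isolated vertices lie in S. It factors over the vertices: the ends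
  of \<open>e\<close> give the indicator of S x S, and the others give the constant K, a power of
  the measure of S.\<close>

lemma mixed_density_square_kernel:
  assumes W: "W \<in> borel_kernels" and S: "S \<in> sets borel" and e: "e \<in> E"
    and cover: "\<And>w. w \<in> \<Union>E \<Longrightarrow> \<exists>e'\<in>E - {e}. w \<in> e'"
    and pos: "0 < (LINT y|unit_lborel. indicator S y :: real)"
  shows "\<exists>K>0. mixed_density (square_kernel S) W {e} =
    K * (LINT p|(unit_lborel \<Otimes>\<^sub>M unit_lborel). W p * square_kernel S p)"
proof -
  let ?P = "\<lambda>I. Pi\<^sub>M I (\<lambda>_. unit_lborel)"
  define u v where "u = edge_src e" and "v = edge_tgt e"
  have uv: "u \<noteq> v" "u \<in> V" "v \<in> V" "e = {u, v}"
    using edge_ends[OF e] by (auto simp: u_def v_def)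
  \<comment> \<open>Isolated vertices are unconstrained and contribute the factor 1.\<close>
  define h where "h w y = (if w \<in> \<Union>E then indicator S y else 1 :: real)" for w y
  define J where "J = V - {u, v}"
  have V_split: "V = {u, v} \<union> J" "{u, v} \<inter> J = {}" "finite J"
    using uv finite_V by (auto simp: J_def)
  have h_prod: "(\<Prod>e'\<in>E - {e}. square_kernel S (x (edge_src e'), x (edge_tgt e'))) = (\<Prod>w\<in>V. h w (x w))" for x
  proof (cases "\<forall>w\<in>\<Union>E. x w \<in> S")
    case True
    have "square_kernel S (x (edge_src e'), x (edge_tgt e')) = 1" if "e' \<in> E - {e}" for e'
    proof -
      have "edge_src e' \<in> \<Union>E" "edge_tgt e' \<in> \<Union>E"
        using edge_ends(1)[of e'] that by blast+
      then have "x (edge_src e') \<in> S" "x (edge_tgt e') \<in> S"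
        using True by blast+
      then show ?thesis
        by (simp add: square_kernel_def)
    qed
    moreover have "h w (x w) = 1" for w
      using True by (auto simp: h_def)
    ultimately show ?thesis
      by simp
  next
    case False
    then obtain w where w: "w \<in> \<Union>E" "x w \<notin> S"
      by blast
    obtain e' where e': "e' \<in> E - {e}" "w \<in> e'"
      using cover[OF w(1)] by blast
    have w_end: "w = edge_src e' \<or> w = edge_tgt e'"
      using edge_ends(1)[of e'] e' by blast
    then have "w \<in> V"
      using edge_ends(3,4)[of e'] e'(1) by auto
    have "square_kernel S (x (edge_src e'), x (edge_tgt e')) = 0" "h w (x w) = 0"
      using w w_end by (auto simp: square_kernel_def h_def)
    then show ?thesis
      using e'(1) \<open>w \<in> V\<close> finite_V finite_E by (subst (1 2) prod_zero) auto
  qed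
  define f where "f x = W (x u, x v) * (\<Prod>w\<in>V. h w (x w))" for x
  define G where "G p = W p * square_kernel S p" for p
  define K where "K = (\<Prod>w\<in>J. LINT y|unit_lborel. h w y)"
  have f_mixed: "f x = (\<Prod>e\<in>{e}. W (x (edge_src e), x (edge_tgt e))) *
      (\<Prod>e'\<in>E - {e}. square_kernel S (x (edge_src e'), x (edge_tgt e')))" for x
    by (simp add: f_def h_prod u_def v_def)
  have S_unit: "integrable unit_lborel (indicator S :: real \<Rightarrow> real)"
    using S by (intro U.integrable_const_bound[where B = 1]) (auto intro: measurable_restrict_space1)
  have h_cases: "h w = indicator S \<or> h w = (\<lambda>y. 1)" for w
    by (cases "w \<in> \<Union>E") (auto simp: h_def fun_eq_iff)
  have h_int: "integrable unit_lborel (h w)" for w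
    using h_cases[of w]
  proof
    assume "h w = indicator S"
    then show ?thesis
      using S_unit by simp
  next
    assume "h w = (\<lambda>y. 1)"
    then show ?thesis
      by simp
  qed
  have h_pos: "0 < (LINT y|unit_lborel. h w y)" for w
    using h_cases[of w]
  proof
    assume "h w = indicator S"
    then show ?thesis
      using pos by simp
  next
    assume "h w = (\<lambda>y. 1)"
    then show ?thesis
      using U.prob_space by simp
  qed
  have "integrable (?P V) f"
    using integrable_mixed[OF square_kernel_in_borel_kernels[OF S] W, of "{e}"] e unfolding f_mixed by simp
  then have "(LINT x|?P V. f x) = (LINT x|?P {u, v}. LINT y|?P J. f (merge {u, v} J (x, y)))"
    using PU.product_integral_fold[OF V_split(2) _ V_split(3), of f] V_split(1) by simp
  also have "\<dots> = (LINT x|?P {u, v}. G (x u, x v) * K)"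
  proof (intro Bochner_Integration.integral_cong refl)
    fix x :: "'a \<Rightarrow> real"
    have "f (merge {u, v} J (x, y)) = G (x u, x v) * (\<Prod>w\<in>J. h w (y w))" for y
    proof -
      have "prod k V = k u * k v * prod k J" for k :: "'a \<Rightarrow> real"
        using V_split(2,3) uv(1) by (subst V_split(1)) (simp add: mult.assoc)
      moreover have "h u = indicator S" "h v = indicator S"
        using uv(4) e by (auto simp: h_def fun_eq_iff)
      moreover have "merge {u, v} J (x, y) u = x u" "merge {u, v} J (x, y) v = x v"
        using V_split(2) by simp_all
      ultimately have "(\<Prod>w\<in>V. h w (merge {u, v} J (x, y) w)) = square_kernel S (x u, x v) * (\<Prod>w\<in>J. h w (merge {u, v} J (x, y) w))"
        by (simp add: square_kernel_def)
      also have "(\<Prod>w\<in>J. h w (merge {u, v} J (x, y) w)) = (\<Prod>w\<in>J. h w (y w))"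
        using V_split(2) by (intro prod.cong) auto
      finally show ?thesis
        using V_split(2) by (simp add: f_def G_def)
    qed
    moreover have "(LINT y|?P J. (\<Prod>w\<in>J. h w (y w))) = K"
      unfolding K_def by (intro PU.product_integral_prod V_split(3) h_int)
    ultimately show "(LINT y|?P J. f (merge {u, v} J (x, y))) = G (x u, x v) * K"
      by simp
  qed
  also have "\<dots> = K * (LINT x|?P {u, v}. G (x u, x v))"
    by simp
  also have "(LINT x|?P {u, v}. G (x u, x v)) = (LINT p|(unit_lborel \<Otimes>\<^sub>M unit_lborel). G p)"
  proof -
    have "G \<in> borel_measurable (unit_lborel \<Otimes>\<^sub>M unit_lborel)"
      using borel_measurable_integrable[OF integrable_kernel_rectangle[OF W S S]]
      by (simp add: G_def[abs_def] square_kernel_def)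
    moreover have "(\<lambda>x. (x u, x v)) \<in> ?P {u, v} \<rightarrow>\<^sub>M unit_lborel \<Otimes>\<^sub>M unit_lborel"
      by measurable
    ultimately have "integral\<^sup>L (distr (?P {u, v}) (unit_lborel \<Otimes>\<^sub>M unit_lborel) (\<lambda>x. (x u, x v))) G =
        (LINT x|?P {u, v}. G (x u, x v))"
      by (intro integral_distr)
    then show ?thesis
      using distr_PiM_pair[of u "{u, v}" v] uv(1) by simp
  qed
  finally have "mixed_density (square_kernel S) W {e} = K * (LINT p|(unit_lborel \<Otimes>\<^sub>M unit_lborel). G p)"
    unfolding mixed_density_def f_mixed .
  moreover have "0 < K"
    unfolding K_def using h_pos by (intro prod_pos)
  ultimately show ?thesis
    unfolding G_def by blast
qed

text \<open>The powers t^k with k \<noteq> 1 have derivative 0 at 0, so only one-element sets of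
  edges survive.\<close>

lemma deriv_sum_Pow_at_0:
  fixes d :: "'a set set \<Rightarrow> real"
  shows "((\<lambda>t. \<Sum>T\<in>Pow E. t ^ card T * d T) has_real_derivative (\<Sum>e\<in>E. d {e})) (at 0)"
proof -
  have "((\<lambda>t::real. t ^ k * c) has_real_derivative (if k = 1 then c else 0)) (at 0)" for k :: nat and c :: real
  proof -
    have "((\<lambda>t::real. t ^ k * c) has_real_derivative (real k * 0 ^ (k - 1) * c)) (at 0)"
      by (auto intro!: derivative_eq_intros)
    moreover have "real k * 0 ^ (k - 1) * c = (if k = 1 then c else 0)"
      by (cases k) (auto simp: power_0_left)
    ultimately show ?thesis
      by simp
  qed
  then have "((\<lambda>t. \<Sum>T\<in>Pow E. t ^ card T * d T) has_real_derivative
      (\<Sum>T\<in>Pow E. if card T = 1 then d T else 0)) (at 0)"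
    by (intro DERIV_sum)
  also have "(\<Sum>T\<in>Pow E. if card T = 1 then d T else 0) = (\<Sum>T\<in>(\<lambda>e. {e}) ` E. d T)"
    using finite_E by (intro sum.mono_neutral_cong_right) (auto simp: card_1_singleton_iff)
  also have "\<dots> = (\<Sum>e\<in>E. d {e})"
    by (subst sum.reindex) (auto simp: inj_on_def)
  finally show ?thesis .
qed

text \<open>U + t W is the convex combination of U / (1 - c) and t W / c with weights 1 - c and c.
  The second kernel has density 0 by homogeneity, however small c is; letting c tend to 0 leaves the
  density of U.\<close>

lemma kernel_density_line_le:
  assumes conv: "\<And>c U W. 0 \<le> c \<Longrightarrow> c \<le> 1 \<Longrightarrow> U \<in> borel_kernels \<Longrightarrow> W \<in> borel_kernels \<Longrightarrow>
      kernel_density (\<lambda>p. c * U p + (1 - c) * W p) \<le> c * kernel_density U + (1 - c) * kernel_density W"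
    and U: "U \<in> borel_kernels" and W: "W \<in> borel_kernels" and zero: "kernel_density W = 0"
  shows "kernel_density (\<lambda>p. U p + t * W p) \<le> kernel_density U"
proof -
  have "kernel_density (\<lambda>p. U p + t * W p) \<le> (1 - c) * ((1 / (1 - c)) ^ card E * kernel_density U)"
    if c: "0 < c" "c < 1" for c
  proof -
    have "(\<lambda>p. (1 / (1 - c)) * U p) \<in> borel_kernels" "(\<lambda>p. (t / c) * W p) \<in> borel_kernels"
      using borel_kernels_lin[OF U U, of "1 / (1 - c)" 0] borel_kernels_lin[OF W W, of "t / c" 0] by simp_all
    from conv[OF _ _ this, of "1 - c"] c show ?thesis
      using kernel_density_scale[of "1 / (1 - c)" U] kernel_density_scale[of "t / c" W] zero by simp
  qed
  then have "\<forall>\<^sub>F c in at_right 0. kernel_density (\<lambda>p. U p + t * W p) \<le> (1 - c) * ((1 / (1 - c)) ^ card E * kernel_density U)"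
    unfolding eventually_at_right_field by (intro exI[of _ 1]) auto
  moreover have "((\<lambda>c. (1 - c) * ((1 / (1 - c)) ^ card E * kernel_density U)) \<longlongrightarrow>
      (1 - 0) * ((1 / (1 - 0)) ^ card E * kernel_density U)) (at_right 0)"
    by (intro tendsto_intros) auto
  ultimately have "kernel_density (\<lambda>p. U p + t * W p) \<le> (1 - 0) * ((1 / (1 - 0)) ^ card E * kernel_density U)"
    by (intro tendsto_lowerbound) auto
  then show ?thesis
    by simp
qed

text \<open>If \<open>kernel_density W = 0\<close>, then convexity makes \<open>t = 0\<close> a maximum of \<open>kernel_density (1\<^bsub>S\<times>S\<^esub> + t W)\<close>. As no vertex
  has degree one, every edge contributes a positive multiple of \<open>\<integral>\<^bsub>S\<times>S\<^esub> W\<close> to the derivative there.\<close>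

lemma kernel_density_eq_0_imp_kernel_zero:
  assumes conv: "\<And>c U W. 0 \<le> c \<Longrightarrow> c \<le> 1 \<Longrightarrow> U \<in> borel_kernels \<Longrightarrow> W \<in> borel_kernels \<Longrightarrow>
      kernel_density (\<lambda>p. c * U p + (1 - c) * W p) \<le> c * kernel_density U + (1 - c) * kernel_density W"
    and cover: "\<And>e w. e \<in> E \<Longrightarrow> w \<in> \<Union>E \<Longrightarrow> \<exists>e'\<in>E - {e}. w \<in> e'"
    and E: "E \<noteq> {}" and W: "W \<in> borel_kernels" and zero: "kernel_density W = 0"
  shows "kernel_eq W (\<lambda>p. 0)"
proof (rule kernel_zero_of_rectangles[OF W], rule integral_rectangles_zero[OF W])
  fix S :: "real set" assume S: "S \<in> sets borel"
  let ?R = "LINT p|(unit_lborel \<Otimes>\<^sub>M unit_lborel). W p * square_kernel S p"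
  note sq = square_kernel_in_borel_kernels[OF S]
  have S_unit: "integrable unit_lborel (indicator S :: real \<Rightarrow> real)"
    using S by (intro U.integrable_const_bound[where B = 1]) (auto intro: measurable_restrict_space1)
  show "?R = 0"
  \<comment> \<open>The factors K are positive only if S has positive measure; over a null set the
    integral vanishes anyway.\<close>
  proof (cases "0 < (LINT y|unit_lborel. indicator S y :: real)")
    case True
    define d where "d = mixed_density (square_kernel S) W"
    have le: "kernel_density (\<lambda>p. square_kernel S p + t * W p) \<le> kernel_density (square_kernel S)" for t
      by (rule kernel_density_line_le[OF _ sq W zero], rule conv)
    have "(\<Sum>e\<in>E. d {e}) = 0"
    proof (rule DERIV_local_max[of "\<lambda>t. kernel_density (\<lambda>p. square_kernel S p + t * W p)" _ 0 1])
      show "((\<lambda>t. kernel_density (\<lambda>p. square_kernel S p + t * W p)) has_real_derivative (\<Sum>e\<in>E. d {e})) (at 0)"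
        unfolding kernel_density_line[OF sq W] d_def by (rule deriv_sum_Pow_at_0)
      show "\<forall>t. \<bar>0 - t\<bar> < 1 \<longrightarrow> kernel_density (\<lambda>p. square_kernel S p + t * W p) \<le> kernel_density (\<lambda>p. square_kernel S p + 0 * W p)"
        by (simp add: le)
    qed simp
    moreover have "\<forall>e\<in>E. \<exists>K>0. d {e} = K * ?R"
      unfolding d_def using mixed_density_square_kernel[OF W S _ cover True] by blast
    then obtain K where K: "\<And>e. e \<in> E \<Longrightarrow> 0 < K e \<and> d {e} = K e * ?R"
      by metis
    ultimately have "sum K E * ?R = 0"
      by (simp add: sum_distrib_right)
    moreover have "0 < sum K E"
      using K E finite_E by (intro sum_pos) auto
    ultimately show ?thesis
      by simp
  next
    case False
    moreover have "0 \<le> (LINT y|unit_lborel. indicator S y :: real)"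
      by (intro Bochner_Integration.integral_nonneg) simp
    ultimately have "(LINT y|unit_lborel. indicator S y :: real) = 0"
      by linarith
    then have "AE y in unit_lborel. indicator S y = (0 :: real)"
      using integral_nonneg_eq_0_iff_AE[OF S_unit] by simp
    then have "AE p in unit_lborel \<Otimes>\<^sub>M unit_lborel. indicator S (fst p) = (0 :: real)"
      by (intro AE_distrD[OF measurable_fst]) (subst U.distr_pair_fst)
    then have "AE p in unit_lborel \<Otimes>\<^sub>M unit_lborel. W p * square_kernel S p = 0"
      by eventually_elim (simp add: square_kernel_def)
    then show ?thesis
      by (rule integral_eq_zero_AE)
  qed
qed

end

section \<open>Step kernels and the space of bounded kernels\<close>

lemma kernel_eq_refl: "kernel_eq U U"
  by (simp add: kernel_eq_iff_AE)

lemma kernel_eq_trans: "kernel_eq U W \<Longrightarrow> kernel_eq W X \<Longrightarrow> kernel_eq U X"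
  unfolding kernel_eq_iff_AE by (elim AE_mp) auto

lemma kernel_eq_lin:
  assumes "kernel_eq U U'" "kernel_eq W W'"
  shows "kernel_eq (kernel_add (kernel_scale a U) (kernel_scale b W)) (\<lambda>p. a * U' p + b * W' p)"
  using assms unfolding kernel_eq_iff_AE
  by (elim AE_mp) (auto simp: kernel_add_def kernel_scale_def)

lemma not_kernel_eq_one_zero: "\<not> kernel_eq (\<lambda>p. 1) (\<lambda>p. 0)"
proof
  assume "kernel_eq (\<lambda>p. 1) (\<lambda>p. 0)"
  then have "AE p in unit_lborel \<Otimes>\<^sub>M unit_lborel. False"
    by (simp add: kernel_eq_iff_AE)
  then show False
    by (simp add: UU.P.AE_False)
qed

lemma kernel_scale_closed:
  assumes W: "W \<in> bounded_kernels"
  shows "kernel_scale c W \<in> bounded_kernels"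
proof -
  have "kernel_scale c W ` unit_square = (\<lambda>x. c *\<^sub>R x) ` (W ` unit_square)"
    by (auto simp: kernel_scale_def image_image)
  then have "bounded (kernel_scale c W ` unit_square)"
    using W by (simp only: bounded_scaling bounded_kernels_def mem_Collect_eq)
  then show ?thesis
    using W by (auto simp: bounded_kernels_def kernel_scale_def symmetric_kernel_def)
qed

lemma kernel_add_closed:
  assumes U: "U \<in> bounded_kernels" and W: "W \<in> bounded_kernels"
  shows "kernel_add U W \<in> bounded_kernels"
proof -
  have "bounded (kernel_add U W ` unit_square)"
    using U W unfolding kernel_add_def by (intro bounded_plus_comp) (auto simp: bounded_kernels_def)
  then show ?thesis
    using U W by (auto simp: bounded_kernels_def kernel_add_def symmetric_kernel_def)
qed

lemma const_in_borel_kernels: "(\<lambda>p. c) \<in> borel_kernels"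
  by (simp add: borel_kernels_def)

lemma signed_graphons_subset: "signed_graphons \<subseteq> bounded_kernels"
  by (auto simp: signed_graphons_def bounded_kernels_def intro: bounded_subset[OF bounded_closed_interval])

lemma const_in_signed_graphons: "\<bar>c\<bar> \<le> 1 \<Longrightarrow> (\<lambda>p. c) \<in> signed_graphons"
  by (auto simp: signed_graphons_def symmetric_kernel_def)

lemma signed_graphon_scaling:
  assumes W: "W \<in> bounded_kernels" and c: "\<bar>c\<bar> * b \<le> 1" and b: "\<And>p. p \<in> unit_square \<Longrightarrow> \<bar>W p\<bar> \<le> b"
  shows "kernel_scale c W \<in> signed_graphons"
proof -
  have "\<bar>c * W p\<bar> \<le> 1" if "p \<in> unit_square" for p
    using mult_left_mono[OF b[OF that], of "\<bar>c\<bar>"] c by (simp add: abs_mult)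
  then have "kernel_scale c W ` unit_square \<subseteq> {-1..1}"
    by (auto simp: kernel_scale_def abs_le_iff)
  then show ?thesis
    using kernel_scale_closed[OF W, of c] by (auto simp: bounded_kernels_def signed_graphons_def)
qed

text \<open>For n > 0 this is total with values below n: \<open>min\<close> puts x = 1 (and
  everything beyond) into the last cell, and \<open>nat\<close> sends negative x to cell 0. Step
  kernels are thus defined on the whole plane.\<close>

definition cell :: "nat \<Rightarrow> real \<Rightarrow> nat" where
  "cell n x = min (n - 1) (nat \<lfloor>real n * x\<rfloor>)"

definition step_kernel :: "nat \<Rightarrow> real mat \<Rightarrow> real \<times> real \<Rightarrow> real" where
  "step_kernel n A p = A $$ (cell n (fst p), cell n (snd p))"

lemma cell_less: "0 < n \<Longrightarrow> cell n x < n"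
  by (auto simp: cell_def)

lemma measurable_cell: "{x. cell n x = i} \<in> sets borel"
proof -
  have "(\<lambda>x. cell n x) \<in> borel \<rightarrow>\<^sub>M count_space UNIV"
    unfolding cell_def by measurable
  from measurable_sets[OF this, of "{i}"] show ?thesis
    by (simp add: vimage_def)
qed

text \<open>Within [0,1] the cell lies between an open and a closed interval of length 1/n, which
  avoids treating the last, closed cell apart.\<close>

lemma measure_cell:
  assumes "i < n"
  shows "(LINT y|unit_lborel. indicator {x. cell n x = i} y :: real) = 1 / real n"
proof -
  let ?S = "{x. cell n x = i} \<inter> {0..1}"
  have n: "0 < real n"
    using assms by simp
  have sub1: "{real i / real n <..< (real i + 1) / real n} \<subseteq> ?S"
  proof
    fix x assume x: "x \<in> {real i / real n <..< (real i + 1) / real n}"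
    have lo: "real i < real n * x" and hi: "real n * x < real i + 1"
      using x n by (auto simp: field_simps)
    have "0 \<le> x"
      using x n by (auto intro: order.trans[of _ "real i / real n"])
    moreover have "x \<le> 1"
    proof -
      have "real n * x \<le> real n * 1"
        using hi assms by linarith
      then show ?thesis
        using n by simp
    qed
    moreover have "\<lfloor>real n * x\<rfloor> = int i"
      using lo hi by (intro floor_unique) auto
    then have "cell n x = i"
      using assms by (simp add: cell_def)
    ultimately show "x \<in> ?S"
      by simp
  qed
  have sub2: "?S \<subseteq> {real i / real n .. (real i + 1) / real n}"
  proof
    fix x assume x: "x \<in> ?S"
    have nx: "0 \<le> real n * x" "real n * x \<le> real n"
      using x n by (auto simp: mult_left_le)
    have "real i \<le> real n * x \<and> real n * x \<le> real i + 1"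
    proof (cases "nat \<lfloor>real n * x\<rfloor> \<le> n - 1")
      case True
      then have "nat \<lfloor>real n * x\<rfloor> = i"
        using x by (auto simp: cell_def)
      then have "\<lfloor>real n * x\<rfloor> = int i"
        using nx(1) by linarith
      then show ?thesis
        by linarith
    next
      case False
      then have "i = n - 1"
        using x by (auto simp: cell_def)
      moreover have "n \<le> nat \<lfloor>real n * x\<rfloor>"
        using False by simp
      then have "real n \<le> real n * x"
        using nx(1) by linarith
      ultimately show ?thesis
        using nx(2) assms by (auto simp: of_nat_diff)
    qed
    then show "x \<in> {real i / real n .. (real i + 1) / real n}"
      using n by (auto simp: field_simps)
  qed
  have S: "?S \<in> sets borel"
    using measurable_cell by auto
  have Icc: "{real i / real n .. (real i + 1) / real n} \<in> fmeasurable lborel"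
    by (rule fmeasurableI) (simp_all add: emeasure_lborel_Icc_eq)
  have "measure lborel ?S = 1 / real n"
  proof (rule antisym)
    have "measure lborel ?S \<le> measure lborel {real i / real n .. (real i + 1) / real n}"
      using sub2 S Icc by (intro measure_mono_fmeasurable) auto
    also have "\<dots> = 1 / real n"
      using n by (simp add: divide_right_mono add_divide_distrib)
    finally show "measure lborel ?S \<le> 1 / real n" .
    have "1 / real n = measure lborel {real i / real n <..< (real i + 1) / real n}"
      using n by (simp add: divide_right_mono add_divide_distrib)
    also have "\<dots> \<le> measure lborel ?S"
      using sub1 S fmeasurableI2[OF Icc sub2] by (intro measure_mono_fmeasurable) auto
    finally show "1 / real n \<le> measure lborel ?S" .
  qed
  then show ?thesis
    using S by (simp add: measure_restrict_space)
qed

lemma step_kernel_in_borel_kernels: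
  assumes n: "0 < n" and A: "A \<in> symmetric_mats n"
  shows "step_kernel n A \<in> borel_kernels"
proof -
  have eq: "step_kernel n A p = (\<Sum>i<n. \<Sum>j<n. A $$ (i, j) *
      (indicator {x. cell n x = i} (fst p) * indicator {x. cell n x = j} (snd p)))" for p
  proof -
    have "(\<Sum>i<n. \<Sum>j<n. A $$ (i, j) * (indicator {x. cell n x = i} (fst p) * indicator {x. cell n x = j} (snd p))) =
        (\<Sum>i<n. \<Sum>j<n. if cell n (snd p) = j then (if cell n (fst p) = i then A $$ (i, j) else 0) else 0)"
      by (intro sum.cong refl) (auto simp: indicator_def)
    also have "\<dots> = step_kernel n A p"
      using cell_less[OF n] by (simp add: step_kernel_def sum.delta)
    finally show ?thesis
      by simp
  qed
  have "step_kernel n A \<in> borel_measurable borel"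
    unfolding eq[abs_def]
    by (intro borel_measurable_sum borel_measurable_times borel_measurable_const
        borel_measurable_rectangle measurable_cell)
  moreover have "range (step_kernel n A) \<subseteq> (\<lambda>p. A $$ p) ` ({..<n} \<times> {..<n})"
    using cell_less[OF n] by (auto simp: step_kernel_def)
  then have "bounded (range (step_kernel n A))"
    by (rule bounded_subset[rotated]) (simp add: finite_imp_bounded)
  moreover have "step_kernel n A (x, y) = step_kernel n A (y, x)" for x y
    using symmetric_mats_swap[OF A cell_less[OF n] cell_less[OF n]] by (simp add: step_kernel_def)
  ultimately show ?thesis
    by (auto simp: borel_kernels_def)
qed

lemma step_kernel_lin:
  assumes "0 < n" "A \<in> symmetric_mats n" "B \<in> symmetric_mats n"
  shows "step_kernel n (a \<cdot>\<^sub>m A + b \<cdot>\<^sub>m B) = kernel_add (kernel_scale a (step_kernel n A)) (kernel_scale b (step_kernel n B))"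
  using cell_less[OF assms(1)] symmetric_mats_dim[OF assms(2)] symmetric_mats_dim[OF assms(3)]
  by (auto simp: step_kernel_def kernel_add_def kernel_scale_def)

text \<open>Every product of two cells has measure 1/n^2 > 0, so entries that differ are seen almost
  everywhere.\<close>

lemma step_kernel_inj:
  assumes n: "0 < n" and A: "A \<in> symmetric_mats n" and B: "B \<in> symmetric_mats n"
    and eq: "kernel_eq (step_kernel n A) (step_kernel n B)"
  shows "A = B"
proof (rule eq_matI)
  note dims = symmetric_mats_dim[OF A] symmetric_mats_dim[OF B]
  fix i j assume "i < dim_row B" "j < dim_col B"
  then have ij: "i < n" "j < n"
    using dims by auto
  show "A $$ (i, j) = B $$ (i, j)"
  proof (rule ccontr)
    assume ne: "A $$ (i, j) \<noteq> B $$ (i, j)"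
    let ?S = "\<lambda>i. {x. cell n x = i} \<inter> {0..1}"
    have sets: "?S i \<in> sets unit_lborel" for i
      using measurable_cell by (auto simp: sets_restrict_space)
    have "AE p in unit_lborel \<Otimes>\<^sub>M unit_lborel. p \<notin> ?S i \<times> ?S j"
      using eq ne unfolding kernel_eq_iff_AE by (elim AE_mp) (auto simp: step_kernel_def)
    then have "?S i \<times> ?S j \<in> null_sets (unit_lborel \<Otimes>\<^sub>M unit_lborel)"
      using sets by (subst AE_iff_null_sets) auto
    then have "emeasure unit_lborel (?S i) * emeasure unit_lborel (?S j) = 0"
      using U.emeasure_pair_measure_Times[OF sets sets, of i j] by auto
    moreover have "measure unit_lborel (?S k) = 1 / real n" if "k < n" for k
      using measure_cell[OF that] by simp
    then have "emeasure unit_lborel (?S k) \<noteq> 0" if "k < n" for k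
      using that n by (auto simp: U.emeasure_eq_measure)
    ultimately show False
      using ij by auto
  qed
qed (use symmetric_mats_dim[OF A] symmetric_mats_dim[OF B] in auto)

section \<open>Densities of step kernels, and the density as a homogeneous form\<close>

context finite_simple_graph
begin

text \<open>A point of the cube determines the colouring of the vertices by cells, and each
  colouring occurs with probability n^(-|V|).\<close>

lemma kernel_density_step_kernel:
  assumes n: "0 < n" and A: "A \<in> symmetric_mats n"
  shows "kernel_density (step_kernel n A) = hom_poly V E n A / real n ^ card V"
proof -
  let ?P = "Pi\<^sub>M V (\<lambda>_. unit_lborel)"
  define a where "a \<phi> = (\<Prod>e\<in>E. A $$ (\<phi> (edge_src e), \<phi> (edge_tgt e)))" for \<phi>
  define ind where "ind \<phi> x = (\<Prod>v\<in>V. indicator {y. cell n y = \<phi> v} (x v) :: real)" for \<phi> and x :: "'a \<Rightarrow> real"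
  have fin: "finite (V \<rightarrow>\<^sub>E {..<n})"
    using finite_V by (intro finite_PiE) auto
  have cell_int: "integrable unit_lborel (indicator {y. cell n y = i} :: real \<Rightarrow> real)" for i
    using measurable_cell
    by (intro U.integrable_const_bound[where B = 1]) (auto intro: measurable_restrict_space1)
  have "edge_prod (step_kernel n A) x = (\<Sum>\<phi>\<in>V \<rightarrow>\<^sub>E {..<n}. a \<phi> * ind \<phi> x)" for x
  proof -
    define \<psi> where "\<psi> = (\<lambda>v\<in>V. cell n (x v))"
    have \<psi>: "\<psi> \<in> V \<rightarrow>\<^sub>E {..<n}"
      using cell_less[OF n] by (auto simp: \<psi>_def)
    have "ind \<phi> x = (if \<phi> = \<psi> then 1 else 0)" if \<phi>: "\<phi> \<in> V \<rightarrow>\<^sub>E {..<n}" for \<phi>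
    proof (cases "\<phi> = \<psi>")
      case True
      then show ?thesis
        by (simp add: ind_def \<psi>_def)
    next
      case False
      then obtain v where "v \<in> V" "\<phi> v \<noteq> \<psi> v"
        using \<phi> \<psi> by (meson PiE_ext)
      then have "indicator {y. cell n y = \<phi> v} (x v) = (0 :: real)"
        by (simp add: \<psi>_def)
      then have "ind \<phi> x = 0"
        unfolding ind_def using finite_V \<open>v \<in> V\<close> by (intro prod_zero) auto
      then show ?thesis
        using False by simp
    qed
    then have "(\<Sum>\<phi>\<in>V \<rightarrow>\<^sub>E {..<n}. a \<phi> * ind \<phi> x) = (\<Sum>\<phi>\<in>V \<rightarrow>\<^sub>E {..<n}. if \<phi> = \<psi> then a \<phi> else 0)"
      by (intro sum.cong) auto
    also have "\<dots> = a \<psi>"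
      using fin \<psi> by simp
    also have "\<dots> = edge_prod (step_kernel n A) x"
      unfolding a_def edge_prod_def using edge_ends(3,4)
      by (intro prod.cong) (auto simp: step_kernel_def \<psi>_def)
    finally show ?thesis
      by simp
  qed
  then have "kernel_density (step_kernel n A) = (LINT x|?P. (\<Sum>\<phi>\<in>V \<rightarrow>\<^sub>E {..<n}. a \<phi> * ind \<phi> x))"
    by (simp add: kernel_density_def)
  also have "\<dots> = (\<Sum>\<phi>\<in>V \<rightarrow>\<^sub>E {..<n}. a \<phi> * (LINT x|?P. ind \<phi> x))"
  proof -
    have "integrable ?P (ind \<phi>)" for \<phi>
      unfolding ind_def by (intro PU.product_integrable_prod finite_V cell_int)
    then show ?thesis
      by (subst Bochner_Integration.integral_sum) auto
  qed
  also have "\<dots> = (\<Sum>\<phi>\<in>V \<rightarrow>\<^sub>E {..<n}. a \<phi> * (1 / real n) ^ card V)"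
  proof (intro sum.cong refl)
    fix \<phi> assume \<phi>: "\<phi> \<in> V \<rightarrow>\<^sub>E {..<n}"
    have "(LINT x|?P. ind \<phi> x) = (\<Prod>v\<in>V. LINT y|unit_lborel. indicator {y. cell n y = \<phi> v} y)"
      unfolding ind_def by (intro PU.product_integral_prod finite_V cell_int)
    also have "\<dots> = (\<Prod>v\<in>V. 1 / real n)"
      using \<phi> by (intro prod.cong refl measure_cell) auto
    finally show "a \<phi> * (LINT x|?P. ind \<phi> x) = a \<phi> * (1 / real n) ^ card V"
      by simp
  qed
  also have "\<dots> = hom_poly V E n A / real n ^ card V"
    unfolding hom_poly_eq[OF A] a_def
    by (simp add: power_divide sum_divide_distrib)
  finally show ?thesis .
qed

lemma hom_density_borel: "W \<in> borel_kernels \<Longrightarrow> hom_density V E W = kernel_density W"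
  using hom_density_eq_integral[of W W] borel_kernels_subset by (auto simp: kernel_density_def kernel_eq_refl)

lemma hom_density_representative:
  assumes "W \<in> bounded_kernels" "W' \<in> borel_kernels" "kernel_eq W W'"
  shows "hom_density V E W = kernel_density W'"
  using hom_density_eq_integral[OF assms] by (simp add: kernel_density_def)

lemma hom_density_lin:
  assumes "U \<in> bounded_kernels" "U' \<in> borel_kernels" "kernel_eq U U'"
    and "W \<in> bounded_kernels" "W' \<in> borel_kernels" "kernel_eq W W'"
  shows "hom_density V E (kernel_add (kernel_scale a U) (kernel_scale b W)) = kernel_density (\<lambda>p. a * U' p + b * W' p)"
  using assms
  by (intro hom_density_representative kernel_add_closed kernel_scale_closed borel_kernels_lin kernel_eq_lin)

lemma homogeneous_form_hom_density:
  assumes "E \<noteq> {}"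
  shows "homogeneous_form bounded_kernels kernel_add kernel_scale (\<lambda>p. 0) kernel_eq (hom_density V E) (card E)"
proof
  show "0 < card E"
    using assms finite_E by (simp add: card_gt_0_iff)
  show "(\<lambda>p. 0) \<in> bounded_kernels"
    using const_in_borel_kernels borel_kernels_subset by blast
  show "hom_density V E U = hom_density V E W"
    if U: "U \<in> bounded_kernels" and W: "W \<in> bounded_kernels" and eq: "kernel_eq U W" for U W
  proof -
    obtain W' where "W' \<in> borel_kernels" "kernel_eq W W'"
      using borel_kernel_representative[OF W] .
    then show ?thesis
      using hom_density_representative U W kernel_eq_trans[OF eq] by metis
  qed
  show "hom_density V E (kernel_scale c W) = c ^ card E * hom_density V E W"
    if W: "W \<in> bounded_kernels" for c W
  proof -
    obtain W' where W': "W' \<in> borel_kernels" "kernel_eq W W'"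
      using borel_kernel_representative[OF W] .
    have "hom_density V E (kernel_scale c W) = kernel_density (\<lambda>p. c * W' p + 0 * W' p)"
      using hom_density_lin[OF W W' W W', of c 0] by (simp add: kernel_add_def kernel_scale_def)
    then show ?thesis
      using kernel_density_scale[of c W'] hom_density_representative[OF W W'] by simp
  qed
  show "\<exists>p. \<forall>t. hom_density V E (kernel_add (kernel_scale t U) (kernel_scale (1 - t) W)) = poly p t"
    if U: "U \<in> bounded_kernels" and W: "W \<in> bounded_kernels" for U W
  proof -
    obtain U' where U': "U' \<in> borel_kernels" "kernel_eq U U'"
      using borel_kernel_representative[OF U] .
    obtain W' where W': "W' \<in> borel_kernels" "kernel_eq W W'"
      using borel_kernel_representative[OF W] .
    \<comment> \<open>The direction of the line, which is then parametrised as W' + t D.\<close>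
    define D where "D = (\<lambda>p. 1 * U' p + (- 1) * W' p)"
    have D: "D \<in> borel_kernels"
      unfolding D_def using U'(1) W'(1) by (rule borel_kernels_lin)
    have "hom_density V E (kernel_add (kernel_scale t U) (kernel_scale (1 - t) W)) =
        poly (\<Sum>T\<in>Pow E. monom (mixed_density W' D T) (card T)) t" for t
    proof -
      have "hom_density V E (kernel_add (kernel_scale t U) (kernel_scale (1 - t) W)) =
          kernel_density (\<lambda>p. t * U' p + (1 - t) * W' p)"
        by (rule hom_density_lin[OF U U' W W'])
      also have "(\<lambda>p. t * U' p + (1 - t) * W' p) = (\<lambda>p. W' p + t * D p)"
        by (simp add: D_def algebra_simps)
      finally show ?thesis
        by (simp only: kernel_density_line[OF W'(1) D] poly_sum_Pow)
    qed
    then show ?thesis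
      by blast
  qed
  show "kernel_eq U W" if "kernel_eq (kernel_add U (kernel_scale (- 1) W)) (\<lambda>p. 0)" for U W
    using that unfolding kernel_eq_iff_AE by (elim AE_mp) (auto simp: kernel_add_def kernel_scale_def)
  show "kernel_eq (kernel_add U X) (kernel_add W X)" if "kernel_eq U W" for U W X
    using that unfolding kernel_eq_iff_AE by (elim AE_mp) (auto simp: kernel_add_def)
  show "kernel_eq (kernel_scale c U) (kernel_scale c W)" if "kernel_eq U W" for c U W
    using that unfolding kernel_eq_iff_AE by (elim AE_mp) (auto simp: kernel_scale_def)
qed (auto simp: kernel_add_closed kernel_scale_closed kernel_eq_refl,
    auto simp: kernel_add_def kernel_scale_def algebra_simps)

end

section \<open>The equivalences\<close>

lemma is_norm_on_cong:
  assumes "\<And>x. x \<in> S \<Longrightarrow> N x = N' x" "\<And>c x. x \<in> S \<Longrightarrow> vscale c x \<in> S"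
    "\<And>x y. x \<in> S \<Longrightarrow> y \<in> S \<Longrightarrow> vadd x y \<in> S"
  shows "is_norm_on S vadd vscale vzero veq N \<longleftrightarrow> is_norm_on S vadd vscale vzero veq N'"
  using assms by (simp add: is_norm_on_def)

lemma zero_in_symmetric_mats: "0\<^sub>m n n \<in> symmetric_mats n"
  by (rule symmetric_matsI) auto

lemma one_in_symmetric_mats: "1\<^sub>m n \<in> symmetric_mats n"
  by (rule symmetric_matsI) auto

context finite_simple_graph
begin

text \<open>Scaling two bounded kernels by a common s > 0 makes them signed graphons, and
  homogeneity multiplies both sides of the inequality by the same positive factor.\<close>

lemma strictly_convex_signed_graphons_iff:
  assumes "E \<noteq> {}"
  shows "is_strictly_convex_on signed_graphons kernel_add kernel_scale kernel_eq (hom_density V E) \<longleftrightarrow>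
    is_strictly_convex_on bounded_kernels kernel_add kernel_scale kernel_eq (hom_density V E)"
    (is "?L \<longleftrightarrow> ?R")
proof
  show "?L" if "?R"
    using that signed_graphons_subset unfolding is_strictly_convex_on_def by blast
  assume L: "?L"
  interpret homogeneous_form bounded_kernels kernel_add kernel_scale "\<lambda>p. 0" kernel_eq "hom_density V E" "card E"
    by (rule homogeneous_form_hom_density[OF assms])
  show "?R"
    unfolding is_strictly_convex_on_def
  proof (intro ballI allI impI)
    fix U W and c :: real
    assume U: "U \<in> bounded_kernels" and W: "W \<in> bounded_kernels" and ne: "\<not> kernel_eq U W" and c: "0 < c" "c < 1"
    obtain b1 b2 where b: "0 < b1" "\<And>p. p \<in> unit_square \<Longrightarrow> \<bar>U p\<bar> \<le> b1"
      "0 < b2" "\<And>p. p \<in> unit_square \<Longrightarrow> \<bar>W p\<bar> \<le> b2"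
      using U W bounded_pos[of "U ` unit_square"] bounded_pos[of "W ` unit_square"]
      unfolding bounded_kernels_def by auto
    define s where "s = 1 / (b1 + b2)"
    have s: "0 < s" "\<bar>s\<bar> * b1 \<le> 1" "\<bar>s\<bar> * b2 \<le> 1"
      using b by (auto simp: s_def field_simps)
    let ?U = "kernel_scale s U" and ?W = "kernel_scale s W"
    let ?X = "kernel_add (kernel_scale c U) (kernel_scale (1 - c) W)"
    have UW: "?U \<in> signed_graphons" "?W \<in> signed_graphons"
      using signed_graphon_scaling U W s b by blast+
    have "\<not> kernel_eq ?U ?W"
    proof
      assume "kernel_eq ?U ?W"
      then have "kernel_eq (kernel_scale (1 / s) ?U) (kernel_scale (1 / s) ?W)"
        by (rule veq_scale[OF scale_closed[OF U] scale_closed[OF W]])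
      then show False
        using ne s(1) U W by (simp add: scale_scale scale_one)
    qed
    then have "hom_density V E (kernel_add (kernel_scale c ?U) (kernel_scale (1 - c) ?W)) <
        c * hom_density V E ?U + (1 - c) * hom_density V E ?W"
      using is_strictly_convex_onD[OF L UW] c by blast
    moreover have "kernel_add (kernel_scale c ?U) (kernel_scale (1 - c) ?W) = kernel_scale s ?X"
      by (auto simp: kernel_add_def kernel_scale_def algebra_simps)
    ultimately have "s ^ card E * hom_density V E ?X < s ^ card E * (c * hom_density V E U + (1 - c) * hom_density V E W)"
      using U W by (simp add: form_scale add_closed scale_closed algebra_simps)
    then show "hom_density V E ?X < c * hom_density V E U + (1 - c) * hom_density V E W"
      using s(1) by simp
  qed
qed

text \<open>If the density changes sign between X and Y, it vanishes somewhere on the segment, so a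
  proper convex combination of X and Y is zero almost everywhere. With an odd number of edges 1 and
  -1 have opposite signs, and a kernel not proportional to 1 contradicts this with one of them. With
  an even number a kernel W of negative density would be a multiple of 1, whose density is
  nonnegative.\<close>

lemma norming_imp_nonneg:
  assumes E: "E \<noteq> {}" and norming: "norming V E" and W: "W \<in> bounded_kernels"
  shows "0 \<le> hom_density V E W"
proof -
  interpret homogeneous_form bounded_kernels kernel_add kernel_scale "\<lambda>p. 0" kernel_eq "hom_density V E" "card E"
    by (rule homogeneous_form_hom_density[OF E])
  let ?f = "hom_density V E"
  let ?comb = "\<lambda>t U W. kernel_add (kernel_scale t U) (kernel_scale (1 - t) W)"
  have zero_iff: "?f X = 0 \<longleftrightarrow> kernel_eq X (\<lambda>p. 0)" if "X \<in> bounded_kernels" for X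
    using norming that m_pos unfolding norming_def is_norm_on_def by (auto simp: real_root_eq_0_iff)
  have sign_change: "\<exists>t. 0 < t \<and> t < 1 \<and> kernel_eq (?comb t X Y) (\<lambda>p. 0)"
    if X: "X \<in> bounded_kernels" and Y: "Y \<in> bounded_kernels" and XY: "?f X < 0" "0 < ?f Y" for X Y
  proof -
    obtain p where p: "\<And>t. ?f (?comb t X Y) = poly p t"
      using form_poly[OF X Y] by blast
    have "poly p 1 < 0" "0 < poly p 0"
      using p[of 1] p[of 0] XY X Y by (auto simp: kernel_add_def kernel_scale_def)
    then obtain t where "0 < t" "t < 1" "poly p t = 0"
      using poly_IVT_neg[of 0 1 p] by auto
    then show ?thesis
      using zero_iff[of "?comb t X Y"] X Y p by (auto simp: add_closed scale_closed)
  qed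
  have one: "(\<lambda>p. 1) \<in> bounded_kernels"
    using const_in_borel_kernels borel_kernels_subset by blast
  have f_one: "?f (\<lambda>p. 1) = 1"
  proof -
    interpret prob_space "Pi\<^sub>M V (\<lambda>_. unit_lborel)"
      by (rule prob_space_PiM_unit_lborel)
    show ?thesis
      using hom_density_borel[OF const_in_borel_kernels] prob_space by (simp add: kernel_density_def edge_prod_def)
  qed
  have even: "even (card E)"
  proof (rule ccontr)
    assume odd: "odd (card E)"
    \<comment> \<open>\<open>J\<close> represents the constant kernel 1; any \<open>D\<close>
      linearly independent of it would serve.\<close>
    define D J where "D = mat 2 2 (\<lambda>p. if p = (0, 0) then 1 else 0 :: real)" and "J = mat 2 2 (\<lambda>p. 1 :: real)"
    have D: "D \<in> symmetric_mats 2" and J: "J \<in> symmetric_mats 2"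
      unfolding D_def J_def by (rule symmetric_matsI; auto)+
    have no_comb: "\<not> kernel_eq (kernel_add (kernel_scale t (step_kernel 2 D)) (kernel_scale s (step_kernel 2 J))) (\<lambda>p. 0)"
      if "t \<noteq> 0 \<or> s \<noteq> 0" for t s
    proof
      assume "kernel_eq (kernel_add (kernel_scale t (step_kernel 2 D)) (kernel_scale s (step_kernel 2 J))) (\<lambda>p. 0)"
      moreover have "step_kernel 2 (0\<^sub>m 2 2) = (\<lambda>p. 0)"
        using cell_less[of 2] by (auto simp: step_kernel_def)
      ultimately have eq: "t \<cdot>\<^sub>m D + s \<cdot>\<^sub>m J = 0\<^sub>m 2 2"
        using D J by (intro step_kernel_inj[of 2])
          (auto simp: step_kernel_lin symmetric_mats_add symmetric_mats_smult zero_in_symmetric_mats)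
      have "(t \<cdot>\<^sub>m D + s \<cdot>\<^sub>m J) $$ (0, 0) = t + s" "(t \<cdot>\<^sub>m D + s \<cdot>\<^sub>m J) $$ (0, 1) = s"
        by (simp_all add: D_def J_def)
      then show False
        using that unfolding eq by simp
    qed
    have J_one: "step_kernel 2 J = (\<lambda>p. 1)"
      using cell_less[of 2] by (auto simp: step_kernel_def J_def)
    let ?U = "step_kernel 2 D"
    have U: "?U \<in> bounded_kernels"
      using step_kernel_in_borel_kernels[of 2 D] D borel_kernels_subset by auto
    have "?f ?U \<noteq> 0"
    proof -
      have "kernel_add (kernel_scale 1 ?U) (kernel_scale 0 (step_kernel 2 J)) = ?U"
        by (simp add: kernel_add_def kernel_scale_def)
      then show ?thesis
        using no_comb[of 1 0] zero_iff[OF U] by simp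
    qed
    \<comment> \<open>The segment joins \<open>?U\<close> to 1 or to -1, whichever has density of
      the opposite sign.\<close>
    then consider "?f ?U < 0" | "0 < ?f ?U"
      by linarith
    then show False
    proof cases
      case 1
      then show False
        using sign_change[OF U one] f_one no_comb unfolding J_one by fastforce
    next
      case 2
      let ?m1 = "kernel_scale (- 1) (\<lambda>p. 1)"
      have m1: "?m1 \<in> bounded_kernels"
        using one by (rule scale_closed)
      have "?f ?m1 < 0"
        using odd f_one by (simp add: form_scale[OF one])
      then obtain t where t: "0 < t" "t < 1" "kernel_eq (?comb t ?m1 ?U) (\<lambda>p. 0)"
        using sign_change[OF m1 U _ 2] by blast
      moreover have "?comb t ?m1 ?U = kernel_add (kernel_scale (1 - t) ?U) (kernel_scale (- t) (\<lambda>p. 1))"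
        by (auto simp: kernel_add_def kernel_scale_def)
      ultimately show False
        using no_comb[of "1 - t" "- t"] unfolding J_one by simp
    qed
  qed
  show ?thesis
  proof (rule ccontr)
    assume "\<not> 0 \<le> ?f W"
    then obtain t where t: "0 < t" "t < 1" "kernel_eq (?comb t W (\<lambda>p. 1)) (\<lambda>p. 0)"
      using sign_change[OF W one] f_one by auto
    have "kernel_eq (kernel_scale t W) (kernel_scale (- (1 - t)) (\<lambda>p. 1))"
      using t(3) unfolding kernel_eq_iff_AE by (elim AE_mp) (auto simp: kernel_add_def kernel_scale_def)
    then have "t ^ card E * ?f W = (- (1 - t)) ^ card E * ?f (\<lambda>p. 1)"
      using W one form_cong[of "kernel_scale t W" "kernel_scale (- (1 - t)) (\<lambda>p. 1)"]
      by (simp only: form_scale scale_closed)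
    also have "\<dots> \<ge> 0"
      using even f_one by (simp add: zero_le_even_power)
    finally show False
      using \<open>\<not> 0 \<le> ?f W\<close> mult_pos_neg[OF zero_less_power[OF t(1)], of "?f W" "card E"] by simp
  qed
qed

lemma norming_iff_strictly_convex:
  assumes E: "E \<noteq> {}"
  shows "norming V E \<longleftrightarrow>
    is_strictly_convex_on bounded_kernels kernel_add kernel_scale kernel_eq (hom_density V E)"
proof -
  interpret homogeneous_form bounded_kernels kernel_add kernel_scale "\<lambda>p. 0" kernel_eq "hom_density V E" "card E"
    by (rule homogeneous_form_hom_density[OF E])
  have norming_iff: "norming V E \<longleftrightarrow> is_norm_on bounded_kernels kernel_add kernel_scale (\<lambda>p. 0) kernel_eq
      (\<lambda>W. root (card E) (hom_density V E W))"
    if "\<And>W. W \<in> bounded_kernels \<Longrightarrow> 0 \<le> hom_density V E W"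
    unfolding norming_def using that by (intro is_norm_on_cong) (auto simp: add_closed scale_closed)
  show ?thesis
  proof
    assume "norming V E"
    then show "is_strictly_convex_on bounded_kernels kernel_add kernel_scale kernel_eq (hom_density V E)"
      using norming_iff norming_imp_nonneg[OF E] norm_imp_strictly_convex by blast
  next
    assume sc: "is_strictly_convex_on bounded_kernels kernel_add kernel_scale kernel_eq (hom_density V E)"
    have "0 \<le> hom_density V E W" if "W \<in> bounded_kernels" for W
      using strictly_convex_imp_pos[OF sc that] form_cong[OF that zero_closed] form_zero
      by (cases "kernel_eq W (\<lambda>p. 0)") auto
    then show "norming V E"
      using norming_iff strictly_convex_imp_norm[OF sc] by blast
  qed
qed

lemma strictly_convex_density_imp_hom_poly:
  assumes sc: "is_strictly_convex_on bounded_kernels kernel_add kernel_scale kernel_eq (hom_density V E)"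
  shows "is_strictly_convex_on (symmetric_mats n) (+) (\<cdot>\<^sub>m) (=) (hom_poly V E n)"
  unfolding is_strictly_convex_on_def
proof (intro ballI allI impI)
  fix A B and c :: real
  assume A: "A \<in> symmetric_mats n" and B: "B \<in> symmetric_mats n" and ne: "A \<noteq> B" and c: "0 < c" "c < 1"
  \<comment> \<open>There is only one 0 x 0 matrix, so distinct matrices exclude n = 0.\<close>
  have n: "0 < n"
  proof (rule ccontr)
    assume "\<not> 0 < n"
    then have "A = B"
      using symmetric_mats_dim[OF A] symmetric_mats_dim[OF B] by (intro eq_matI) auto
    with ne show False ..
  qed
  let ?C = "c \<cdot>\<^sub>m A + (1 - c) \<cdot>\<^sub>m B"
  have C: "?C \<in> symmetric_mats n"
    using A B by (intro symmetric_mats_add symmetric_mats_smult)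
  have step: "hom_density V E (step_kernel n X) = hom_poly V E n X / real n ^ card V"
    if "X \<in> symmetric_mats n" for X
    using that n by (simp add: hom_density_borel step_kernel_in_borel_kernels kernel_density_step_kernel)
  have "hom_density V E (step_kernel n ?C) <
      c * hom_density V E (step_kernel n A) + (1 - c) * hom_density V E (step_kernel n B)"
    unfolding step_kernel_lin[OF n A B]
  proof (rule is_strictly_convex_onD[OF sc _ _ _ c])
    show "step_kernel n A \<in> bounded_kernels" "step_kernel n B \<in> bounded_kernels"
      using step_kernel_in_borel_kernels[OF n] A B borel_kernels_subset by auto
    show "\<not> kernel_eq (step_kernel n A) (step_kernel n B)"
      using step_kernel_inj[OF n A B] ne by blast
  qed
  then show "hom_poly V E n ?C < c * hom_poly V E n A + (1 - c) * hom_poly V E n B"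
    using n by (simp add: step A B C field_simps)
qed

lemma strictly_convex_hom_poly_imp_density:
  assumes E: "E \<noteq> {}"
    and sc: "\<And>n. is_strictly_convex_on (symmetric_mats n) (+) (\<cdot>\<^sub>m) (=) (hom_poly V E n)"
  shows "is_strictly_convex_on bounded_kernels kernel_add kernel_scale kernel_eq (hom_density V E)"
proof -
  interpret mats: homogeneous_form "symmetric_mats n" "(+)" "(\<cdot>\<^sub>m)" "0\<^sub>m n n" "(=)" "hom_poly V E n" "card E" for n
    by (rule homogeneous_form_hom_poly[OF E])
  interpret homogeneous_form bounded_kernels kernel_add kernel_scale "\<lambda>p. 0" kernel_eq "hom_density V E" "card E"
    by (rule homogeneous_form_hom_density[OF E])
  have hom_poly_nonneg: "0 \<le> hom_poly V E n A" if "A \<in> symmetric_mats n" for n A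
    using mats.strictly_convex_imp_pos[OF sc that] mats.form_zero by (cases "A = 0\<^sub>m n n") auto
  have conv: "kernel_density (\<lambda>p. c * U p + (1 - c) * W p) \<le> c * kernel_density U + (1 - c) * kernel_density W"
    if "0 \<le> c" "c \<le> 1" "U \<in> borel_kernels" "W \<in> borel_kernels" for c U W
    using that by (intro kernel_density_convex mats.strictly_convex_imp_convex[OF sc])
  have cover: "\<exists>e'\<in>E - {e}. w \<in> e'" if e: "e \<in> E" and w: "w \<in> \<Union>E" for e w
  proof -
    let ?A = "mat 2 2 (\<lambda>(i, j). if i = j then 1 else - 1) :: real mat"
    have A: "?A \<in> symmetric_mats 2"
      by (rule symmetric_matsI) auto
    have "?A $$ (0, 0) \<noteq> 0\<^sub>m 2 2 $$ (0, 0)"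
      by simp
    then have "0 < hom_poly V E 2 ?A"
      using mats.strictly_convex_imp_pos[OF sc A] by metis
    moreover have "w \<in> V"
      using w graph by (auto simp: simple_graph_def)
    \<comment> \<open>The degree of a vertex lying on \<open>e\<close> is even and not 0, so a
      second edge passes through it.\<close>
    ultimately have even: "even (card {e \<in> E. w \<in> e})"
      using odd_degree_hom_poly_eq_0 by fastforce
    show ?thesis
    proof (rule ccontr)
      assume "\<not> ?thesis"
      then have "{e' \<in> E. w \<in> e'} = {e}"
        using w e by auto
      then show False
        using even by simp
    qed
  qed
  have "is_norm_on bounded_kernels kernel_add kernel_scale (\<lambda>p. 0) kernel_eq (\<lambda>W. root (card E) (hom_density V E W))"
  proof (rule convex_imp_norm)
    fix W assume W: "W \<in> bounded_kernels" and ne: "\<not> kernel_eq W (\<lambda>p. 0)"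
    obtain W' where W': "W' \<in> borel_kernels" "kernel_eq W W'"
      using borel_kernel_representative[OF W] .
    have "kernel_density W' \<noteq> 0"
      using kernel_density_eq_0_imp_kernel_zero[OF conv cover E W'(1)] kernel_eq_trans[OF W'(2)] ne by blast
    moreover have "0 \<le> kernel_density W'"
      using hom_poly_nonneg W'(1) by (rule kernel_density_nonneg)
    ultimately show "0 < hom_density V E W"
      using hom_density_representative[OF W W'] by simp
  next
    fix U W and c :: real
    assume U: "U \<in> bounded_kernels" and W: "W \<in> bounded_kernels" and c: "0 \<le> c" "c \<le> 1"
    obtain U' where U': "U' \<in> borel_kernels" "kernel_eq U U'"
      using borel_kernel_representative[OF U] .
    obtain W' where W': "W' \<in> borel_kernels" "kernel_eq W W'"
      using borel_kernel_representative[OF W] .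
    show "hom_density V E (kernel_add (kernel_scale c U) (kernel_scale (1 - c) W)) \<le>
        c * hom_density V E U + (1 - c) * hom_density V E W"
      using conv[OF c U'(1) W'(1)] hom_density_lin[OF U U' W W']
        hom_density_representative[OF U U'] hom_density_representative[OF W W'] by simp
  qed
  then show ?thesis
    by (rule norm_imp_strictly_convex)
qed

text \<open>Empty products make the density and the polynomial constant, so strict convexity fails,
  and \<open>root 0\<close> is constantly 0, so definiteness fails. Size 1 already provides two
  distinct matrices.\<close>

lemma edgeless_fails:
  assumes E: "E = {}"
  shows "\<not> norming V E"
    and "\<not> is_strictly_convex_on signed_graphons kernel_add kernel_scale kernel_eq (hom_density V E)"
    and "\<not> is_strictly_convex_on (symmetric_mats 1) (+) (\<cdot>\<^sub>m) (=) (hom_poly V E 1)"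
    and "\<not> is_norm_on (symmetric_mats 1) (+) (\<cdot>\<^sub>m) (0\<^sub>m 1 1) (=) (\<lambda>A. root (card E) (hom_poly V E 1 A))"
proof -
  have "1\<^sub>m 1 $$ (0, 0) \<noteq> (0\<^sub>m 1 1 $$ (0, 0) :: real)"
    by simp
  then have ne: "1\<^sub>m 1 \<noteq> (0\<^sub>m 1 1 :: real mat)"
    by metis
  have one: "(\<lambda>p. 1) \<in> bounded_kernels"
    using const_in_borel_kernels borel_kernels_subset by blast
  show "\<not> norming V E"
    using one not_kernel_eq_one_zero unfolding norming_def is_norm_on_def by (auto simp: E)
  show "\<not> is_norm_on (symmetric_mats 1) (+) (\<cdot>\<^sub>m) (0\<^sub>m 1 1) (=) (\<lambda>A. root (card E) (hom_poly V E 1 A))"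
    using one_in_symmetric_mats[of 1] ne unfolding is_norm_on_def by (auto simp: E)
  show "\<not> is_strictly_convex_on signed_graphons kernel_add kernel_scale kernel_eq (hom_density V E)"
  proof
    assume sc: "is_strictly_convex_on signed_graphons kernel_add kernel_scale kernel_eq (hom_density V E)"
    have const: "hom_density V E U = hom_density V E W" for U W
      by (simp add: hom_density_def E)
    show False
      using is_strictly_convex_onD[OF sc, of "\<lambda>p. 1" "\<lambda>p. 0" "1/2"] not_kernel_eq_one_zero
        const_in_signed_graphons[of 1] const_in_signed_graphons[of 0]
        const[of "kernel_add (kernel_scale (1/2) (\<lambda>p. 1)) (kernel_scale (1 - 1/2) (\<lambda>p. 0))" "\<lambda>p. 0"]
        const[of "\<lambda>p. 1" "\<lambda>p. 0"] by simp
  qed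
  show "\<not> is_strictly_convex_on (symmetric_mats 1) (+) (\<cdot>\<^sub>m) (=) (hom_poly V E 1)"
  proof
    assume sc: "is_strictly_convex_on (symmetric_mats 1) (+) (\<cdot>\<^sub>m) (=) (hom_poly V E 1)"
    have const: "hom_poly V E 1 A = hom_poly V E 1 B" for A B
      by (simp add: hom_poly_def E)
    show False
      using is_strictly_convex_onD[OF sc, of "1\<^sub>m 1" "0\<^sub>m 1 1" "1/2"] one_in_symmetric_mats[of 1]
        zero_in_symmetric_mats[of 1] ne
        const[of "(1/2) \<cdot>\<^sub>m 1\<^sub>m 1 + (1 - 1/2) \<cdot>\<^sub>m 0\<^sub>m 1 1" "0\<^sub>m 1 1"] const[of "1\<^sub>m 1" "0\<^sub>m 1 1"] by simp
  qed
qed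

end

theorem theorem4p1:
  fixes V :: "'a set" and E :: "'a set set"
  assumes "simple_graph V E"
  shows "(norming V E \<longleftrightarrow>
            is_strictly_convex_on signed_graphons kernel_add kernel_scale kernel_eq (hom_density V E))
       \<and> (is_strictly_convex_on signed_graphons kernel_add kernel_scale kernel_eq (hom_density V E) \<longleftrightarrow>
            (\<forall>n::nat. is_strictly_convex_on (symmetric_mats n) (+) (\<cdot>\<^sub>m) (=) (hom_poly V E n)))
       \<and> ((\<forall>n::nat. is_strictly_convex_on (symmetric_mats n) (+) (\<cdot>\<^sub>m) (=) (hom_poly V E n)) \<longleftrightarrow>
            (\<forall>n::nat. is_norm_on (symmetric_mats n) (+) (\<cdot>\<^sub>m) (0\<^sub>m n n) (=)
                        (\<lambda>A. root (card E) (hom_poly V E n A))))"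
proof -
  interpret finite_simple_graph V E
    by standard fact
  show ?thesis
  proof (cases "E = {}")
    case True
    then show ?thesis
      using edgeless_fails by blast
  next
    case False
    show ?thesis
      using norming_iff_strictly_convex[OF False] strictly_convex_signed_graphons_iff[OF False]
        strictly_convex_density_imp_hom_poly strictly_convex_hom_poly_imp_density[OF False]
        homogeneous_form.strictly_convex_iff_norm[OF homogeneous_form_hom_poly[OF False]]
      by blast
  qed
qed

end
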